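(* Let $\mathbb{K}$ be a field, $S=\mathbb{K}[x_1,\ldots,x_m,x_{m+1},\ldots,x_{2m}]$, and let $H$ be a simple graph on $\{x_1,\ldots,x_m\}$. Let $I\subseteq S$ be a support-$2$ monomial ideal such that $G(I)$ is the whiskered graph $W_H$, i.e. $E(G(I))=E(H)\cup\{\{x_1,x_{m+1}\},\ldots,\{x_m,x_{2m}\}\}$. Then the following are equivalent: (1) $S/I$ is Cohen-Macaulay; (2) $I$ is unmixed; (3) $I$ does not have any embedded associated primes; (4) for all $1\le i\le m$, $\alpha_{i,m+i}=1$ and $w^1_{i,m+i}\ge \mu_{i,j}$ for every $1\le j\le m$ with $\{x_i,x_j\}\in E(H)$.
   Context: For a monomial ideal $I$, $\mathcal{G}(I)$ denotes its minimal set of monomial generators. $I$ is a support-$2$ monomial ideal if every element of $\mathcal{G}(I)$ has the form $x_i^ax_j^b$ with $i< j$ and $a,b\ge 1$. The underlying simple graph $G(I)$ has an edge $\{x_i,x_j\}$ whenever some element of $\mathcal{G}(I)$ has support $\{x_i,x_j\}$. For an edge $\{x_i,x_j\}$, $\alpha_{i,j}$ is the number of elements of $\mathcal{G}(I)$ with support exactly $\{x_i,x_j\}$, and $\mu_{i,j}$ is the maximum exponent of $x_i$ among these generators. When $\alpha_{i,m+i}=1$, $w^1_{i,m+i}$ denotes the exponent of $x_i$ in the unique element of $\mathcal{G}(I)$ with support $\{x_i,x_{m+i}\}$ (in general $w^1_{i,m+i}=\mu_{i,m+i}$). $I$ is unmixed if all its associated primes have the same height. *)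

theory Defs
  imports "HOL-Library.Poly_Mapping" "HOL-Library.Extended_Nat"
begin

type_synonym ('v, 'k) mpoly = "('v \<Rightarrow>\<^sub>0 nat) \<Rightarrow>\<^sub>0 'k"

definition monom :: "('v \<Rightarrow>\<^sub>0 nat) \<Rightarrow> ('v, 'k::field) mpoly" where
  "monom e = Poly_Mapping.single e 1"

definition var :: "'v \<Rightarrow> ('v, 'k::field) mpoly" where
  "var v = monom (Poly_Mapping.single v 1)"

definition is_ideal :: "('v, 'k::field) mpoly set \<Rightarrow> bool" where
  "is_ideal I \<longleftrightarrow> 0 \<in> I \<and> (\<forall>f\<in>I. \<forall>g\<in>I. f + g \<in> I) \<and> (\<forall>f\<in>I. \<forall>g. g * f \<in> I)"

definition ideal_gen :: "('v, 'k::field) mpoly set \<Rightarrow> ('v, 'k) mpoly set" where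
  "ideal_gen A = \<Inter> {J. is_ideal J \<and> A \<subseteq> J}"

definition prime_ideal :: "('v, 'k::field) mpoly set \<Rightarrow> bool" where
  "prime_ideal P \<longleftrightarrow> is_ideal P \<and> P \<noteq> UNIV \<and> (\<forall>a b. a * b \<in> P \<longrightarrow> a \<in> P \<or> b \<in> P)"

definition monomial_ideal :: "('v, 'k::field) mpoly set \<Rightarrow> bool" where
  "monomial_ideal I \<longleftrightarrow> is_ideal I \<and> I = ideal_gen {monom e | e. monom e \<in> I}"

definition mdvd :: "('v \<Rightarrow>\<^sub>0 nat) \<Rightarrow> ('v \<Rightarrow>\<^sub>0 nat) \<Rightarrow> bool" where
  "mdvd e e' \<longleftrightarrow> (\<forall>v. Poly_Mapping.lookup e v \<le> Poly_Mapping.lookup e' v)"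

definition min_gens :: "('v, 'k::field) mpoly set \<Rightarrow> ('v \<Rightarrow>\<^sub>0 nat) set" where
  "min_gens I = {e. (monom e :: ('v,'k) mpoly) \<in> I \<and>
      \<not> (\<exists>e'. (monom e' :: ('v,'k) mpoly) \<in> I \<and> mdvd e' e \<and> e' \<noteq> e)}"

definition support2 :: "('v, 'k::field) mpoly set \<Rightarrow> bool" where
  "support2 I \<longleftrightarrow> monomial_ideal I \<and> (\<forall>e\<in>min_gens I. card (Poly_Mapping.keys e) = 2)"

definition graph_edges :: "('v, 'k::field) mpoly set \<Rightarrow> 'v set set" where
  "graph_edges I = Poly_Mapping.keys ` min_gens I"

definition alpha :: "('v, 'k::field) mpoly set \<Rightarrow> 'v \<Rightarrow> 'v \<Rightarrow> nat" where
  "alpha I u v = card {e\<in>min_gens I. Poly_Mapping.keys e = {u, v}}"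

text \<open>mu_{u,v}: maximal exponent of u among minimal generators with support {u,v}.
  (When alpha_{u,v}=1 this is the exponent w^1_{u,v} of u in the unique such generator.)\<close>
definition mu :: "('v, 'k::field) mpoly set \<Rightarrow> 'v \<Rightarrow> 'v \<Rightarrow> nat" where
  "mu I u v = Max {Poly_Mapping.lookup e u | e. e \<in> min_gens I \<and> Poly_Mapping.keys e = {u, v}}"

definition ass :: "('v, 'k::field) mpoly set \<Rightarrow> ('v, 'k) mpoly set set" where
  "ass I = {P. prime_ideal P \<and> (\<exists>f. P = {g. g * f \<in> I})}"

definition prime_chain :: "('v, 'k::field) mpoly set list \<Rightarrow> bool" where
  "prime_chain Ps \<longleftrightarrow> Ps \<noteq> [] \<and> (\<forall>P\<in>set Ps. prime_ideal P) \<and>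
     (\<forall>i. Suc i < length Ps \<longrightarrow> Ps ! i \<subset> Ps ! Suc i)"

definition height :: "('v, 'k::field) mpoly set \<Rightarrow> enat" where
  "height P = Sup {enat (length Ps - 1) | Ps. prime_chain Ps \<and> last Ps = P}"

definition krull_dim_quot :: "('v, 'k::field) mpoly set \<Rightarrow> enat" where
  "krull_dim_quot I = Sup {enat (length Ps - 1) | Ps. prime_chain Ps \<and> I \<subseteq> hd Ps}"

definition irrelevant :: "('v, 'k::field) mpoly set" where
  "irrelevant = ideal_gen (range var)"

definition regular_seq :: "('v, 'k::field) mpoly set \<Rightarrow> ('v, 'k) mpoly list \<Rightarrow> bool" where
  "regular_seq I fs \<longleftrightarrow> set fs \<subseteq> irrelevant \<and>
     ideal_gen (I \<union> set fs) \<noteq> UNIV \<and>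
     (\<forall>k < length fs. \<forall>g. fs ! k * g \<in> ideal_gen (I \<union> set (take k fs))
          \<longrightarrow> g \<in> ideal_gen (I \<union> set (take k fs)))"

definition depth_quot :: "('v, 'k::field) mpoly set \<Rightarrow> enat" where
  "depth_quot I = Sup {enat (length fs) | fs. regular_seq I fs}"

text \<open>S/I Cohen-Macaulay (graded setting): depth_m(S/I) = dim(S/I).\<close>
definition cohen_macaulay_quot :: "('v, 'k::field) mpoly set \<Rightarrow> bool" where
  "cohen_macaulay_quot I \<longleftrightarrow> depth_quot I = krull_dim_quot I"

definition unmixed :: "('v, 'k::field) mpoly set \<Rightarrow> bool" where
  "unmixed I \<longleftrightarrow> (\<forall>P\<in>ass I. \<forall>Q\<in>ass I. height P = height Q)"

definition has_embedded_prime :: "('v, 'k::field) mpoly set \<Rightarrow> bool" where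
  "has_embedded_prime I \<longleftrightarrow> (\<exists>P\<in>ass I. \<exists>Q\<in>ass I. Q \<subset> P)"

end

theory Submission
  imports Defs "HOL-Library.FuncSet"
begin

text \<open>
  Write \<open>x\<^sub>i\<close> for \<open>Inl i\<close> and \<open>y\<^sub>i\<close> for its whisker \<open>Inr i\<close>. Condition (4) says that a generator supported on
  \<open>{x\<^sub>i, y\<^sub>i}\<close> has the largest exponent of \<open>x\<^sub>i\<close> among all minimal generators.

  The tool behind all bounds on dimension, height and depth is algebraic dependence: more than \<open>d\<close>
  polynomials in \<open>d\<close> variables satisfy a polynomial relation, and evaluating its lexicographically
  least term along a chain of primes, or along a regular sequence, is contradictory. Applied to high
  powers of a regular sequence this gives \<open>depth (S/I) \<le> dim (S/P)\<close> for \<open>P = (I : h)\<close>, \<open>h\<close> a monomial.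

  If (4) holds, the elements \<open>y\<^sub>i - x\<^sub>i\<close> form a regular sequence of length \<open>m = dim (S/I)\<close>; in particular
  no associated prime contains both \<open>x\<^sub>i\<close> and \<open>y\<^sub>i\<close>, so each is generated by exactly \<open>m\<close> variables.
  If (4) fails, some monomial \<open>h\<close> outside \<open>I\<close> is killed by powers of both \<open>x\<^sub>i\<close> and \<open>y\<^sub>i\<close>. Inverting as many
  variables as possible yields an associated prime containing \<open>x\<^sub>i\<close> and \<open>y\<^sub>i\<close>; it has more than \<open>m\<close>
  generators and is embedded, because a minimal vertex cover never contains both.
\<close>

abbreviation lookup :: "('a \<Rightarrow>\<^sub>0 'b::zero) \<Rightarrow> 'a \<Rightarrow> 'b" where "lookup \<equiv> Poly_Mapping.lookup"
abbreviation keys :: "('a \<Rightarrow>\<^sub>0 'b::zero) \<Rightarrow> 'a set" where "keys \<equiv> Poly_Mapping.keys"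
abbreviation single :: "'a \<Rightarrow> 'b \<Rightarrow> 'a \<Rightarrow>\<^sub>0 'b::zero" where "single \<equiv> Poly_Mapping.single"

section \<open>Finitely supported functions\<close>

lemma poly_mapping_add_induct [case_names zero add]:
  fixes p :: "'a \<Rightarrow>\<^sub>0 'b::monoid_add"
  assumes "P 0" and "\<And>p a b. P p \<Longrightarrow> P (p + single a b)"
  shows "P p"
proof (induction p rule: update_induct)
  case const
  show ?case by fact
next
  case (update f a b)
  have "Poly_Mapping.update a b f = f + single a b"
    using update(1)
    by (intro poly_mapping_eqI) (auto simp: lookup_update lookup_add lookup_single in_keys_iff when_def)
  with assms(2)[OF update(3)] show ?case by simp
qed

lemma exponent_induct [case_names zero step]:
  fixes e :: "'a \<Rightarrow>\<^sub>0 nat"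
  assumes "P 0" and step: "\<And>e a. P e \<Longrightarrow> P (e + single a 1)"
  shows "P e"
proof (induction e rule: poly_mapping_add_induct)
  case zero
  show ?case by fact
next
  case (add p a b)
  show ?case
  proof (induction b)
    case 0
    show ?case using add by simp
  next
    case (Suc b)
    have "p + single a (Suc b) = (p + single a b) + single a 1"
      by (metis Suc_eq_plus1 add.assoc single_add)
    then show ?case using step[OF Suc] by simp
  qed
qed

lemma poly_mapping_sum_single: "p = (\<Sum>k\<in>keys p. single k (lookup p k))"
  by (rule poly_mapping_eqI)
     (auto simp: lookup_sum lookup_single when_def in_keys_iff
       intro!: sum.neutral simp: sum.delta)

lemma lookup_single_mult:
  fixes p :: "'a::cancel_comm_monoid_add \<Rightarrow>\<^sub>0 'b::comm_semiring_1"
  shows "lookup (single d c * p) (d + e) = c * lookup p e"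
  by (induction p rule: poly_mapping_add_induct)
     (auto simp: distrib_left lookup_add mult_single lookup_single when_def)

lemma keys_multE:
  assumes "e \<in> keys (p * q)"
  obtains a b where "a \<in> keys p" "b \<in> keys q" "e = a + b"
  using assms keys_mult[of p q] by blast

text \<open>Pushforward along \<open>f\<close>: coefficients at indices with equal image are added.
  On exponent vectors it substitutes variables for variables; applied once more, it carries this
  substitution to polynomials.\<close>

definition map_keys :: "('a \<Rightarrow> 'c) \<Rightarrow> ('a \<Rightarrow>\<^sub>0 'b) \<Rightarrow> ('c \<Rightarrow>\<^sub>0 'b::comm_monoid_add)" where
  "map_keys f p = (\<Sum>k\<in>keys p. single (f k) (lookup p k))"

lemma map_keys_superset:
  assumes "finite K" "keys p \<subseteq> K"
  shows "map_keys f p = (\<Sum>k\<in>K. single (f k) (lookup p k))"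
  unfolding map_keys_def using assms
  by (intro sum.mono_neutral_left) (auto simp: in_keys_iff)

lemma map_keys_zero [simp]: "map_keys f 0 = 0"
  by (simp add: map_keys_def)

lemma map_keys_add: "map_keys f (p + q) = map_keys f p + map_keys f q"
proof -
  have "keys (p + q) \<subseteq> keys p \<union> keys q" by (rule keys_add)
  then show ?thesis
    by (simp add: map_keys_superset[of "keys p \<union> keys q"] lookup_add single_add sum.distrib)
qed

lemma map_keys_single [simp]: "map_keys f (single k c) = single (f k) c"
  by (simp add: map_keys_superset[of "{k}"])

lemma map_keys_diff:
  fixes p q :: "'a \<Rightarrow>\<^sub>0 'b::ab_group_add"
  shows "map_keys f (p - q) = map_keys f p - map_keys f q"
  using map_keys_add[of f "p - q" q] by (simp add: algebra_simps)

lemma map_keys_mult: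
  fixes p q :: "'a::comm_monoid_add \<Rightarrow>\<^sub>0 'b::comm_semiring_1"
    and f :: "'a \<Rightarrow> 'c::comm_monoid_add"
  assumes "\<And>a b. f (a + b) = f a + f b"
  shows "map_keys f (p * q) = map_keys f p * map_keys f q"
proof (induction p rule: poly_mapping_add_induct)
  case (add p a b)
  have "map_keys f (single a b * q) = single (f a) b * map_keys f q"
    by (induction q rule: poly_mapping_add_induct)
       (auto simp: algebra_simps map_keys_add mult_single assms)
  with add show ?case by (simp add: algebra_simps map_keys_add)
qed simp

lemma keys_map_keys: "keys (map_keys f p) \<subseteq> f ` keys p"
  unfolding map_keys_def by (rule order_trans[OF keys_sum]) (auto split: if_splits)

lemma lookup_map_keys:
  assumes "\<And>k'. f k' = f k \<Longrightarrow> k' = k"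
  shows "lookup (map_keys f p) (f k) = lookup p k"
proof -
  have "lookup (map_keys f p) (f k) = (\<Sum>k'\<in>keys p. lookup p k' when k' = k)"
    unfolding map_keys_def lookup_sum
    by (intro sum.cong) (auto simp: lookup_single when_def dest: assms)
  then show ?thesis by (auto simp: when_def in_keys_iff sum.delta)
qed

lemma map_keys_inj:
  assumes "inj f"
  shows "inj (map_keys f)"
proof (rule injI)
  fix p q assume "map_keys f p = map_keys f q"
  then have "lookup p k = lookup q k" for k
    using lookup_map_keys[of f k p] lookup_map_keys[of f k q] assms by (metis injD)
  then show "p = q" by (rule poly_mapping_eqI)
qed

section \<open>Polynomials\<close>

text \<open>Exponent vectors indexed by \<open>nat\<close> are linearly ordered, so leading terms
  exclude zero divisors there. An injective numbering of the finitely many variables transports this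
  back.\<close>

lemma poly_no_zero_divisors:
  fixes p q :: "('v::finite, 'k::field) mpoly"
  assumes "p * q = 0"
  shows "p = 0 \<or> q = 0"
proof -
  obtain f :: "'v \<Rightarrow> nat" where f: "inj f"
    using finite_imp_inj_to_nat_seg[of "UNIV :: 'v set"] by auto
  define s :: "('v \<Rightarrow>\<^sub>0 nat) \<Rightarrow> (nat \<Rightarrow>\<^sub>0 nat)" where "s = map_keys f"
  have "map_keys s p * map_keys s q = map_keys s (p * q)"
    by (rule map_keys_mult[symmetric]) (simp add: s_def map_keys_add)
  then have "map_keys s p = 0 \<or> map_keys s q = 0"
    using assms by simp
  moreover have "inj (map_keys s :: ('v, 'k) mpoly \<Rightarrow> _)"
    unfolding s_def by (intro map_keys_inj f)
  ultimately show ?thesis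
    by (metis injD map_keys_zero)
qed

lemma monom_zero: "monom 0 = 1"
  by (simp add: monom_def)

lemma monom_add: "monom (d + e) = monom d * monom e"
  by (simp add: monom_def mult_single)

lemma keys_monom [simp]: "keys (monom e :: ('v, 'k::field) mpoly) = {e}"
  by (simp add: monom_def)

lemma keys_monom_mult: "keys (monom d * p) = (+) d ` keys p"
proof
  show "keys (monom d * p) \<subseteq> (+) d ` keys p"
    using keys_mult[of "monom d" p] by auto
  have "lookup (monom d * p) (d + e) = lookup p e" for e
    by (simp add: monom_def lookup_single_mult)
  then show "(+) d ` keys p \<subseteq> keys (monom d * p)"
    by (auto simp: in_keys_iff)
qed

lemma single_eq_const_monom: "single e c = single 0 c * (monom e :: ('v, 'k::field) mpoly)"
  by (simp add: monom_def mult_single)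

lemma polynomial_induct [case_names const var add mult]:
  fixes p :: "('v, 'k::field) mpoly"
  assumes const: "\<And>c. P (single 0 c)" and var: "\<And>v. P (var v)"
    and add: "\<And>p q. P p \<Longrightarrow> P q \<Longrightarrow> P (p + q)"
    and mult: "\<And>p q. P p \<Longrightarrow> P q \<Longrightarrow> P (p * q)"
  shows "P p"
proof (induction p rule: poly_mapping_add_induct)
  case zero
  then show ?case using const[of 0] by simp
next
  case (add p e c)
  have "P (monom e)"
  proof (induction e rule: exponent_induct)
    case zero
    then show ?case using const[of 1] by (simp add: monom_def)
  next
    case (step e a)
    then show ?case using mult var by (auto simp: monom_add var_def)
  qed
  then have "P (single e c)"
    using single_eq_const_monom[of e c] mult const by metis
  with add show ?case by (intro assms(3))
qed

section \<open>Total degree and divisibility of monomials\<close>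

definition degree :: "('v \<Rightarrow>\<^sub>0 nat) \<Rightarrow> nat" where
  "degree e = (\<Sum>v\<in>keys e. lookup e v)"

lemma degree_eq:
  fixes e :: "'v::finite \<Rightarrow>\<^sub>0 nat"
  shows "degree e = (\<Sum>v\<in>UNIV. lookup e v)"
  unfolding degree_def by (rule sum.mono_neutral_left) (auto simp: in_keys_iff)

lemma degree_zero [simp]: "degree 0 = 0"
  by (simp add: degree_def)

lemma degree_single [simp]: "degree (single v n) = n"
  by (simp add: degree_def)

lemma degree_add:
  fixes d e :: "'v::finite \<Rightarrow>\<^sub>0 nat"
  shows "degree (d + e) = degree d + degree e"
  by (simp add: degree_eq lookup_add sum.distrib)

lemma mdvd_iff: "mdvd d e \<longleftrightarrow> (\<exists>c. e = d + c)"
proof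
  assume "mdvd d e"
  then have "e = d + (e - d)"
    by (intro poly_mapping_eqI) (auto simp: mdvd_def lookup_add lookup_minus)
  then show "\<exists>c. e = d + c" ..
qed (auto simp: mdvd_def lookup_add)

section \<open>Ideals\<close>

lemma ideal_zero: "is_ideal J \<Longrightarrow> 0 \<in> J"
  and ideal_add: "is_ideal J \<Longrightarrow> f \<in> J \<Longrightarrow> g \<in> J \<Longrightarrow> f + g \<in> J"
  and ideal_mult: "is_ideal J \<Longrightarrow> f \<in> J \<Longrightarrow> g * f \<in> J"
  by (auto simp: is_ideal_def)

lemma ideal_mult': "is_ideal J \<Longrightarrow> f \<in> J \<Longrightarrow> f * g \<in> J"
  using ideal_mult[of J f g] by (simp add: mult.commute)

lemma ideal_uminus: "is_ideal J \<Longrightarrow> f \<in> J \<Longrightarrow> - f \<in> J"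
  using ideal_mult[of J f "-1"] by simp

lemma ideal_diff: "is_ideal J \<Longrightarrow> f \<in> J \<Longrightarrow> g \<in> J \<Longrightarrow> f - g \<in> J"
  using ideal_add[of J f "- g"] ideal_uminus by fastforce

lemma ideal_sum: "is_ideal J \<Longrightarrow> (\<And>a. a \<in> A \<Longrightarrow> f a \<in> J) \<Longrightarrow> sum f A \<in> J"
  by (induction A rule: infinite_finite_induct) (auto intro: ideal_zero ideal_add)

lemma ideal_cong: "is_ideal J \<Longrightarrow> f - g \<in> J \<Longrightarrow> f \<in> J \<longleftrightarrow> g \<in> J"
  using ideal_add[of J "f - g" g] ideal_diff[of J f "f - g"] by auto

lemma ideal_eq_UNIV: "is_ideal J \<Longrightarrow> 1 \<in> J \<Longrightarrow> J = UNIV"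
  using ideal_mult[of J 1] by auto

lemma is_ideal_ideal_gen: "is_ideal (ideal_gen A)"
  by (auto simp: ideal_gen_def is_ideal_def)

lemma ideal_gen_superset: "A \<subseteq> ideal_gen A"
  by (auto simp: ideal_gen_def)

lemma ideal_gen_least: "is_ideal J \<Longrightarrow> A \<subseteq> J \<Longrightarrow> ideal_gen A \<subseteq> J"
  by (auto simp: ideal_gen_def)

section \<open>Monomial ideals as upward closed sets of exponents\<close>

definition upclosed :: "('v \<Rightarrow>\<^sub>0 nat) set \<Rightarrow> bool" where
  "upclosed M \<longleftrightarrow> (\<forall>e\<in>M. \<forall>d. d + e \<in> M)"

lemma upclosedD: "upclosed M \<Longrightarrow> e \<in> M \<Longrightarrow> d + e \<in> M" "upclosed M \<Longrightarrow> e \<in> M \<Longrightarrow> e + d \<in> M"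
  by (auto simp: upclosed_def add.commute)

lemma is_ideal_keys_subset:
  assumes "upclosed M"
  shows "is_ideal {p :: ('v, 'k::field) mpoly. keys p \<subseteq> M}"
  unfolding is_ideal_def
proof (intro conjI ballI allI)
  fix f g :: "('v, 'k) mpoly" assume "f \<in> {p. keys p \<subseteq> M}" "g \<in> {p. keys p \<subseteq> M}"
  then show "f + g \<in> {p. keys p \<subseteq> M}" using keys_add[of f g] by auto
next
  fix f g :: "('v, 'k) mpoly" assume "f \<in> {p. keys p \<subseteq> M}"
  then show "g * f \<in> {p. keys p \<subseteq> M}"
    using assms by (auto elim!: keys_multE simp: upclosed_def)
qed simp

definition exps :: "('v, 'k::field) mpoly set \<Rightarrow> ('v \<Rightarrow>\<^sub>0 nat) set" where
  "exps I = {e. monom e \<in> I}"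

lemma upclosed_exps: "is_ideal I \<Longrightarrow> upclosed (exps I)"
  by (auto simp: upclosed_def exps_def monom_add ideal_mult)

lemma keys_subset_exps_imp:
  assumes "is_ideal I" "keys p \<subseteq> exps I"
  shows "p \<in> I"
proof -
  have "single k (lookup p k) \<in> I" if "k \<in> keys p" for k
    using assms that by (subst single_eq_const_monom) (auto simp: exps_def intro!: ideal_mult)
  then have "(\<Sum>k\<in>keys p. single k (lookup p k)) \<in> I"
    by (intro ideal_sum assms)
  then show ?thesis using poly_mapping_sum_single[of p] by simp
qed

text \<open>The polynomials with all exponents in \<open>exps I\<close> form an ideal containing the
  monomial generators.\<close>

lemma monomial_ideal_iff:
  assumes "monomial_ideal I"
  shows "p \<in> I \<longleftrightarrow> keys p \<subseteq> exps I"
proof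
  have I: "is_ideal I" "I = ideal_gen {monom e | e. monom e \<in> I}"
    using assms unfolding monomial_ideal_def by blast+
  have "ideal_gen {monom e | e. monom e \<in> I} \<subseteq> {p. keys p \<subseteq> exps I}"
    by (intro ideal_gen_least is_ideal_keys_subset upclosed_exps I) (auto simp: exps_def)
  then show "p \<in> I \<Longrightarrow> keys p \<subseteq> exps I" using I by blast
qed (use assms keys_subset_exps_imp in \<open>auto simp: monomial_ideal_def\<close>)

lemma ex_split_keys:
  fixes p :: "('v, 'k::field) mpoly"
  obtains q r where "p = q + r" "keys q \<subseteq> - M" "keys r \<subseteq> M"
proof
  let ?q = "\<Sum>k\<in>keys p - M. single k (lookup p k)"
  let ?r = "\<Sum>k\<in>keys p \<inter> M. single k (lookup p k)"
  show "p = ?q + ?r"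
    by (subst poly_mapping_sum_single[of p], subst sum.Int_Diff[of _ _ M]) simp_all
  show "keys ?q \<subseteq> - M"
    by (rule order_trans[OF keys_sum]) (auto split: if_splits)
  show "keys ?r \<subseteq> M"
    by (rule order_trans[OF keys_sum]) (auto split: if_splits)
qed

lemma ex_min_gen:
  fixes I :: "('v::finite, 'k::field) mpoly set"
  assumes "e \<in> exps I"
  shows "\<exists>g\<in>min_gens I. mdvd g e"
  using assms
proof (induction "degree e" arbitrary: e rule: less_induct)
  case less
  show ?case
  proof (cases "e \<in> min_gens I")
    case True
    then show ?thesis by (auto simp: mdvd_def)
  next
    case False
    then obtain d where d: "d \<in> exps I" "mdvd d e" "d \<noteq> e"
      using less.prems by (auto simp: min_gens_def exps_def)
    then obtain c where c: "e = d + c" by (auto simp: mdvd_iff)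
    then have "c \<noteq> 0" using d by auto
    then have "degree c > 0" unfolding degree_def by (intro sum_pos) (auto simp: in_keys_iff)
    then have "degree d < degree e" by (simp add: c degree_add)
    from less.hyps[OF this d(1)] d(2) show ?thesis by (auto simp: mdvd_def intro: le_trans)
  qed
qed

lemma min_gens_subset: "g \<in> min_gens I \<Longrightarrow> g \<in> exps I"
  by (auto simp: min_gens_def exps_def)

lemma exps_iff:
  fixes I :: "('v::finite, 'k::field) mpoly set"
  assumes "is_ideal I"
  shows "e \<in> exps I \<longleftrightarrow> (\<exists>g\<in>min_gens I. mdvd g e)"
  using ex_min_gen upclosedD(2)[OF upclosed_exps[OF assms]] min_gens_subset
  by (metis mdvd_iff)

lemma min_gens_antichain: "g \<in> min_gens I \<Longrightarrow> g' \<in> min_gens I \<Longrightarrow> mdvd g g' \<Longrightarrow> g = g'"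
  by (auto simp: min_gens_def)

section \<open>Regular sequences\<close>

text \<open>For an ideal \<open>J\<close> this is \<open>J + (f)\<close>, written with a cofactor
  \<open>c\<close> so that congruences can be manipulated directly.\<close>

definition adjoin :: "('v, 'k::field) mpoly set \<Rightarrow> ('v, 'k) mpoly \<Rightarrow> ('v, 'k) mpoly set" where
  "adjoin J f = {p. \<exists>c. p - c * f \<in> J}"

lemma is_ideal_adjoin:
  assumes "is_ideal J"
  shows "is_ideal (adjoin J f)"
  unfolding is_ideal_def
proof (intro conjI ballI allI)
  show "0 \<in> adjoin J f"
    using ideal_zero[OF assms] by (auto simp: adjoin_def intro!: exI[of _ 0])
next
  fix p q assume "p \<in> adjoin J f" "q \<in> adjoin J f"
  then obtain c d where "p - c * f \<in> J" "q - d * f \<in> J" by (auto simp: adjoin_def)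
  then have "p + q - (c + d) * f \<in> J"
    using ideal_add[OF assms, of "p - c * f" "q - d * f"] by (simp add: algebra_simps)
  then show "p + q \<in> adjoin J f" by (auto simp: adjoin_def)
next
  fix p q assume "p \<in> adjoin J f"
  then obtain c where "p - c * f \<in> J" by (auto simp: adjoin_def)
  then have "q * p - (q * c) * f \<in> J"
    using ideal_mult[OF assms, of "p - c * f" q] by (simp add: algebra_simps)
  then show "q * p \<in> adjoin J f" unfolding adjoin_def by blast
qed

lemma adjoin_superset: "J \<subseteq> adjoin J f"
  by (auto simp: adjoin_def intro!: exI[of _ 0])

lemma in_adjoin: "is_ideal J \<Longrightarrow> f \<in> adjoin J f"
  by (auto simp: adjoin_def ideal_zero intro!: exI[of _ 1])

lemma adjoin_least:
  assumes "is_ideal J'" "J \<subseteq> J'" "f \<in> J'"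
  shows "adjoin J f \<subseteq> J'"
proof
  fix p assume "p \<in> adjoin J f"
  then obtain c where "p - c * f \<in> J'" using assms by (auto simp: adjoin_def)
  then show "p \<in> J'"
    using ideal_cong[OF assms(1)] ideal_mult[OF assms(1,3)] by blast
qed

lemma adjoin_commute: "adjoin (adjoin J f) g = adjoin (adjoin J g) f"
proof -
  have "(\<exists>c d. p - c * g - d * f \<in> J) \<longleftrightarrow> (\<exists>d c. p - d * f - c * g \<in> J)" for p
    by (subst diff_right_commute) (rule ex_comm)
  then show ?thesis by (simp add: adjoin_def)
qed

lemma ideal_gen_insert:
  assumes "is_ideal J"
  shows "ideal_gen (J \<union> insert f A) = ideal_gen (adjoin J f \<union> A)"
proof
  have "J \<union> insert f A \<subseteq> adjoin J f \<union> A"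
    using in_adjoin[OF assms] adjoin_superset[of J f] by blast
  also have "\<dots> \<subseteq> ideal_gen (adjoin J f \<union> A)" by (rule ideal_gen_superset)
  finally show "ideal_gen (J \<union> insert f A) \<subseteq> ideal_gen (adjoin J f \<union> A)"
    by (rule ideal_gen_least[OF is_ideal_ideal_gen])
  have sub: "J \<union> insert f A \<subseteq> ideal_gen (J \<union> insert f A)" by (rule ideal_gen_superset)
  then have "adjoin J f \<subseteq> ideal_gen (J \<union> insert f A)"
    by (intro adjoin_least is_ideal_ideal_gen) blast+
  with sub have "adjoin J f \<union> A \<subseteq> ideal_gen (J \<union> insert f A)" by blast
  then show "ideal_gen (adjoin J f \<union> A) \<subseteq> ideal_gen (J \<union> insert f A)"
    by (rule ideal_gen_least[OF is_ideal_ideal_gen])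
qed

lemma ideal_gen_ideal: "is_ideal J \<Longrightarrow> ideal_gen J = J"
  using ideal_gen_least[of J J] ideal_gen_superset[of J] by auto

lemma ideal_gen_Un_list:
  "is_ideal J \<Longrightarrow> ideal_gen (J \<union> set fs) = foldl adjoin J fs"
proof (induction fs arbitrary: J)
  case Nil
  then show ?case by (simp add: ideal_gen_ideal)
next
  case (Cons f fs)
  have "ideal_gen (J \<union> set (f # fs)) = ideal_gen (adjoin J f \<union> set fs)"
    using ideal_gen_insert[OF Cons.prems] by simp
  then show ?case using Cons.IH[OF is_ideal_adjoin[OF Cons.prems]] by simp
qed

definition nzd_mod :: "('v, 'k::field) mpoly set \<Rightarrow> ('v, 'k) mpoly \<Rightarrow> bool" where
  "nzd_mod J f \<longleftrightarrow> (\<forall>g. f * g \<in> J \<longrightarrow> g \<in> J)"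

lemma nzd_modD: "nzd_mod J f \<Longrightarrow> f * g \<in> J \<Longrightarrow> g \<in> J"
  by (auto simp: nzd_mod_def)

lemma nzd_mod_power: "nzd_mod J f \<Longrightarrow> nzd_mod J (f ^ n)"
proof (induction n)
  case (Suc n)
  show ?case
    unfolding nzd_mod_def power_Suc mult.assoc using nzd_modD[OF Suc.prems] nzd_modD[OF Suc.IH[OF Suc.prems]]
    by blast
qed (simp add: nzd_mod_def)

text \<open>Weak, because the quotient may become zero: properness of the final ideal is a separate
  condition in \<open>regular_seq\<close>.\<close>

fun weakly_regular :: "('v, 'k::field) mpoly set \<Rightarrow> ('v, 'k) mpoly list \<Rightarrow> bool" where
  "weakly_regular J [] \<longleftrightarrow> True"
| "weakly_regular J (f # fs) \<longleftrightarrow> nzd_mod J f \<and> weakly_regular (adjoin J f) fs"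

lemma weakly_regular_iff:
  "is_ideal J \<Longrightarrow> weakly_regular J fs \<longleftrightarrow>
    (\<forall>k < length fs. nzd_mod (ideal_gen (J \<union> set (take k fs))) (fs ! k))"
proof (induction fs arbitrary: J)
  case (Cons f fs)
  have "(\<forall>k < length (f # fs). nzd_mod (ideal_gen (J \<union> set (take k (f # fs)))) ((f # fs) ! k))
     \<longleftrightarrow> nzd_mod J f \<and>
       (\<forall>k < length fs. nzd_mod (ideal_gen (adjoin J f \<union> set (take k fs))) (fs ! k))"
    using Cons.prems
    by (simp add: All_less_Suc2 ideal_gen_ideal ideal_gen_insert del: Un_insert_right)
  then show ?case using Cons.IH[OF is_ideal_adjoin[OF Cons.prems]] by simp
qed simp

text \<open>A relation \<open>x * w = c * y\<close> modulo \<open>J\<close> forces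
  \<open>c = e * x\<close> modulo \<open>J\<close> for some \<open>e\<close>; cancelling
  \<open>x\<close> gives \<open>w = e * y\<close> modulo \<open>J\<close>.\<close>

lemma nzd_mod_swap:
  assumes J: "is_ideal J" and x: "nzd_mod J x" and y: "nzd_mod (adjoin J x) y"
  shows "nzd_mod (adjoin J y) x"
  unfolding nzd_mod_def
proof (intro allI impI)
  fix w assume "x * w \<in> adjoin J y"
  then obtain c where c: "x * w - c * y \<in> J" by (auto simp: adjoin_def)
  have "y * c - w * x \<in> J"
    using ideal_uminus[OF J c] by (simp add: algebra_simps)
  then have "c \<in> adjoin J x"
    using nzd_modD[OF y, of c] by (auto simp: adjoin_def)
  then obtain e where e: "c - e * x \<in> J" by (auto simp: adjoin_def)
  have "x * (w - e * y) \<in> J"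
    using ideal_add[OF J c ideal_mult[OF J e, of y]] by (simp add: algebra_simps)
  then show "w \<in> adjoin J y"
    using nzd_modD[OF x] by (auto simp: adjoin_def)
qed

text \<open>Induction on \<open>a\<close>, starting from the unit ideal. If \<open>y * g\<close>
  lies in \<open>adjoin J (x ^ Suc a)\<close>, then \<open>g = e * x\<close> modulo
  \<open>J\<close>; cancelling \<open>x\<close> leaves \<open>y * e\<close> in
  \<open>adjoin J (x ^ a)\<close>, where the induction hypothesis applies.\<close>

lemma nzd_mod_adjoin_power:
  assumes J: "is_ideal J" and x: "nzd_mod J x" and y: "nzd_mod (adjoin J x) y"
  shows "nzd_mod (adjoin J (x ^ a)) y"
proof (induction a)
  case 0
  have "g \<in> adjoin J (x ^ 0)" for g
    using ideal_zero[OF J] unfolding adjoin_def mem_Collect_eq by (intro exI[of _ g]) simp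
  then show ?case by (simp add: nzd_mod_def)
next
  case (Suc a)
  show ?case
    unfolding nzd_mod_def
  proof (intro allI impI)
    fix g assume "y * g \<in> adjoin J (x ^ Suc a)"
    then obtain c where c: "y * g - c * x ^ Suc a \<in> J" by (auto simp: adjoin_def)
    then have "y * g - (c * x ^ a) * x \<in> J" by (simp add: algebra_simps)
    then have "g \<in> adjoin J x"
      using nzd_modD[OF y, of g] unfolding adjoin_def by blast
    then obtain e where e: "g - e * x \<in> J" by (auto simp: adjoin_def)
    have "x * (y * e - c * x ^ a) \<in> J"
      using ideal_diff[OF J c ideal_mult[OF J e, of y]] by (simp add: algebra_simps)
    then have "e \<in> adjoin J (x ^ a)"
      using nzd_modD[OF x] nzd_modD[OF Suc] unfolding adjoin_def by blast
    then obtain d where d: "e - d * x ^ a \<in> J" by (auto simp: adjoin_def)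
    have "g - d * x ^ Suc a \<in> J"
      using ideal_add[OF J e ideal_mult[OF J d, of x]] by (simp add: algebra_simps)
    then show "g \<in> adjoin J (x ^ Suc a)" unfolding adjoin_def by blast
  qed
qed

text \<open>\<open>nzd_mod_swap\<close> moves \<open>x\<close> past the second element
  \<open>y\<close>, so that the induction hypothesis applies over \<open>adjoin J y\<close>.\<close>

lemma weakly_regular_power_hd:
  "is_ideal J \<Longrightarrow> weakly_regular J (x # xs) \<Longrightarrow> weakly_regular J (x ^ a # xs)"
proof (induction xs arbitrary: J)
  case Nil
  then show ?case by (simp add: nzd_mod_power)
next
  case (Cons y ys)
  then have xy: "nzd_mod J x" "nzd_mod (adjoin J x) y" "weakly_regular (adjoin (adjoin J x) y) ys"
    by auto
  then have "weakly_regular (adjoin J y) (x # ys)"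
    using nzd_mod_swap[OF Cons.prems(1) xy(1,2)] by (simp add: adjoin_commute)
  then have "weakly_regular (adjoin J y) (x ^ a # ys)"
    using Cons.IH is_ideal_adjoin[OF Cons.prems(1)] by blast
  then show ?case
    using nzd_mod_power[OF xy(1)] nzd_mod_adjoin_power[OF Cons.prems(1) xy(1,2)]
    by (simp add: adjoin_commute)
qed

lemma weakly_regular_powers:
  "is_ideal J \<Longrightarrow> weakly_regular J xs \<Longrightarrow> weakly_regular J (map (\<lambda>x. x ^ a) xs)"
proof (induction xs arbitrary: J)
  case (Cons x xs)
  then have "weakly_regular J (x ^ a # xs)" by (intro weakly_regular_power_hd)
  then show ?case using Cons.IH[OF is_ideal_adjoin[OF Cons.prems(1)]] by simp
qed simp

text \<open>This covers both weakly regular sequences, with the ideals obtained by adjoining elements, and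
  chains of prime ideals \<open>P\<^sub>0 \<subset> P\<^sub>1 \<subset> \<dots>\<close>, with elements of \<open>P\<^sub>i\<^sub>+\<^sub>1 - P\<^sub>i\<close>.\<close>

inductive nzd_chain :: "('v, 'k::field) mpoly set \<Rightarrow> ('v, 'k) mpoly list \<Rightarrow> ('v, 'k) mpoly set \<Rightarrow> bool"
where
  Nil: "is_ideal J \<Longrightarrow> nzd_chain J [] J"
| Cons: "is_ideal J \<Longrightarrow> nzd_mod J f \<Longrightarrow> J \<subseteq> J1 \<Longrightarrow> f \<in> J1 \<Longrightarrow> nzd_chain J1 fs J' \<Longrightarrow>
    nzd_chain J (f # fs) J'"

lemma nzd_chain_is_ideal: "nzd_chain J fs J' \<Longrightarrow> is_ideal J"
  by (induction rule: nzd_chain.induct)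

lemma weakly_regular_nzd_chain:
  "is_ideal J \<Longrightarrow> weakly_regular J fs \<Longrightarrow> nzd_chain J fs (foldl adjoin J fs)"
proof (induction fs arbitrary: J)
  case Nil
  then show ?case by (auto intro: nzd_chain.Nil)
next
  case (Cons f fs)
  then show ?case
    using adjoin_superset[of J f] in_adjoin[of J f] is_ideal_adjoin[of J f]
    by (auto intro!: nzd_chain.Cons[of _ _ "adjoin J f"])
qed

fun power_prod :: "'r::comm_ring_1 list \<Rightarrow> nat list \<Rightarrow> 'r" where
  "power_prod (f # fs) (a # as) = f ^ a * power_prod fs as"
| "power_prod _ _ = 1"

text \<open>Cancel the smallest power of the first element, then discard the terms still divisible by it:
  they lie in the next ideal.\<close>

lemma nzd_chain_relation:
  fixes c :: "nat list \<Rightarrow> 'k::field"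
  assumes "nzd_chain J fs J'"
    and "finite L" "L \<noteq> {}" "\<And>l. l \<in> L \<Longrightarrow> length l = length fs \<and> c l \<noteq> 0"
    and "(\<Sum>l\<in>L. single 0 (c l) * power_prod fs l * h) \<in> J"
  shows "h \<in> J'"
  using assms
proof (induction arbitrary: L c rule: nzd_chain.induct)
  case (Nil J)
  \<comment> \<open>Only the empty exponent list is possible, so the relation is a nonzero constant
    times \<open>h\<close>, and the constant is invertible.\<close>
  then have "L = {[]}" by auto
  then have "single 0 (inverse (c [])) * (single 0 (c []) * h) \<in> J"
    using Nil by (intro ideal_mult[of J "single 0 (c []) * h"]) auto
  moreover have "c [] \<noteq> 0" using Nil(4) \<open>L = {[]}\<close> by auto
  then have "single 0 (inverse (c [])) * (single 0 (c []) * h) = h"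
    by (simp add: mult_single mult.assoc[symmetric])
  ultimately show ?case by simp
next
  case (Cons J f J1 fs J')
  define a where "a = Min (hd ` L)"
  define K where "K = {l \<in> L. hd l = a}"
  have a_le: "a \<le> hd l" if "l \<in> L" for l
    unfolding a_def using Cons.prems(1) that by (intro Min_le) auto
  have "a \<in> hd ` L" unfolding a_def using Cons.prems by (intro Min_in) auto
  then have K: "K \<noteq> {}" "finite K" "K \<subseteq> L" using Cons.prems by (auto simp: K_def)
  have pp: "power_prod (f # fs) l = f ^ hd l * power_prod fs (tl l)" if "l \<in> L" for l
    using Cons.prems(3)[OF that] by (cases l) auto
  \<comment> \<open>After \<open>f ^ a\<close> is cancelled, the terms outside \<open>K\<close>
    still contain \<open>f\<close>. One further factor is taken out of them, hence the
    \<open>- 1\<close>; \<open>s\<close> collects the terms with exponent exactly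
    \<open>a\<close>.\<close>
  define r where "r = (\<Sum>l\<in>L - K. single 0 (c l) * f ^ (hd l - a - 1) * power_prod fs (tl l) * h)"
  define s where "s = (\<Sum>l\<in>K. single 0 (c l) * power_prod fs (tl l) * h)"
  have "(\<Sum>l\<in>L. single 0 (c l) * power_prod (f # fs) l * h)
      = (\<Sum>l\<in>L - K. single 0 (c l) * power_prod (f # fs) l * h)
        + (\<Sum>l\<in>K. single 0 (c l) * power_prod (f # fs) l * h)"
    using K Cons.prems(1) by (intro sum.subset_diff)
  also have "(\<Sum>l\<in>K. single 0 (c l) * power_prod (f # fs) l * h) = f ^ a * s"
    unfolding s_def sum_distrib_left
  proof (rule sum.cong)
    fix l assume "l \<in> K"
    then have "power_prod (f # fs) l = f ^ a * power_prod fs (tl l)"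
      using pp by (auto simp: K_def)
    then show "single 0 (c l) * power_prod (f # fs) l * h
        = f ^ a * (single 0 (c l) * power_prod fs (tl l) * h)"
      by (simp only: ac_simps)
  qed simp
  also have "(\<Sum>l\<in>L - K. single 0 (c l) * power_prod (f # fs) l * h) = f ^ a * (f * r)"
    unfolding r_def sum_distrib_left
  proof (rule sum.cong)
    fix l assume l: "l \<in> L - K"
    then have "a < hd l" using a_le[of l] by (auto simp: K_def)
    then have "f ^ hd l = f ^ a * (f * f ^ (hd l - a - 1))"
      by (simp flip: power_Suc power_add)
    then have "power_prod (f # fs) l = f ^ a * (f * f ^ (hd l - a - 1)) * power_prod fs (tl l)"
      using pp l by auto
    then show "single 0 (c l) * power_prod (f # fs) l * h
        = f ^ a * (f * (single 0 (c l) * f ^ (hd l - a - 1) * power_prod fs (tl l) * h))"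
      by (simp only: ac_simps)
  qed simp
  finally have "f ^ a * (f * r + s) \<in> J"
    using Cons.prems(4) by (simp add: distrib_left)
  then have "f * r + s \<in> J1"
    using nzd_modD[OF nzd_mod_power[OF Cons.hyps(2)]] Cons.hyps(3) by blast
  moreover have J1: "is_ideal J1" using Cons.hyps(5) nzd_chain_is_ideal by blast
  ultimately have "s \<in> J1"
    using ideal_diff[OF J1, of "f * r + s" "f * r"] ideal_mult'[OF J1 Cons.hyps(4), of r] by simp
  define c' where "c' = (\<lambda>l. c (a # l))"
  have Kl: "l = a # tl l" if "l \<in> K" for l
    using that Cons.prems(3)[of l] by (cases l) (auto simp: K_def)
  have "s = (\<Sum>l\<in>tl ` K. single 0 (c' l) * power_prod fs l * h)"
    unfolding s_def
  proof (subst sum.reindex)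
    show "inj_on tl K" using Kl by (metis inj_onI)
    show "(\<Sum>l\<in>K. single 0 (c l) * power_prod fs (tl l) * h)
        = sum ((\<lambda>l. single 0 (c' l) * power_prod fs l * h) \<circ> tl) K"
      using Kl by (intro sum.cong) (auto simp: c'_def)
  qed
  moreover have "length l = length fs \<and> c' l \<noteq> 0" if "l \<in> tl ` K" for l
  proof -
    from that obtain l' where l': "l' \<in> K" "l = tl l'" by auto
    then have "a # l \<in> L" using Kl[of l'] K(3) by auto
    from Cons.prems(3)[OF this] show ?thesis by (auto simp: c'_def)
  qed
  ultimately show ?case
    using Cons.IH[of "tl ` K" c'] K \<open>s \<in> J1\<close> by auto
qed

section \<open>Linear and algebraic dependence of polynomials\<close>

text \<open>All \<open>q l\<close> lie in the span of \<open>card W\<close> monomials. A repeated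
  value gives a relation with coefficients \<open>1\<close> and \<open>- 1\<close>; otherwise
  \<open>L'\<close> keeps only the terms with nonzero coefficient.\<close>

lemma linear_dependence:
  fixes q :: "'l \<Rightarrow> ('v, 'k::field) mpoly"
  assumes fin: "finite L" "finite W" and card: "card W < card L"
    and keys: "\<And>l. l \<in> L \<Longrightarrow> keys (q l) \<subseteq> W"
  shows "\<exists>L' c. finite L' \<and> L' \<subseteq> L \<and> L' \<noteq> {} \<and> (\<forall>l\<in>L'. c l \<noteq> 0) \<and> (\<Sum>l\<in>L'. single 0 (c l) * q l) = 0"
proof (cases "inj_on q L")
  case False
  then obtain l l' where l: "l \<in> L" "l' \<in> L" "l \<noteq> l'" "q l = q l'" by (auto simp: inj_on_def)
  define c where "c = (\<lambda>x. if x = l then 1 else - 1 :: 'k)"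
  have "(\<Sum>x\<in>{l, l'}. single 0 (c x) * q x) = 0"
    using l by (simp add: c_def single_uminus)
  then show ?thesis using l by (intro exI[of _ "{l, l'}"] exI[of _ c]) (auto simp: c_def)
next
  case True
  interpret vector_space "\<lambda>(c::'k) (p::('v, 'k) mpoly). single 0 c * p"
    by unfold_locales (auto simp: algebra_simps single_add mult_single)
  have span: "q ` L \<subseteq> span (monom ` W)"
  proof
    fix p assume "p \<in> q ` L"
    then have "keys p \<subseteq> W" using keys by auto
    then have "(\<Sum>k\<in>keys p. single 0 (lookup p k) * monom k) \<in> span (monom ` W)"
      by (intro span_sum span_scale span_base) auto
    then show "p \<in> span (monom ` W)"
      using poly_mapping_sum_single[of p] single_eq_const_monom by (metis (mono_tags, lifting) sum.cong)
  qed
  have "dependent (q ` L)"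
  proof (rule ccontr)
    assume "independent (q ` L)"
    from independent_span_bound[OF _ this span] fin have "card (q ` L) \<le> card (monom ` W :: ('v,'k) mpoly set)"
      by auto
    also have "\<dots> \<le> card W" using fin by (intro card_image_le)
    finally show False using card card_image[OF True] by simp
  qed
  then obtain t u where t: "finite t" "t \<subseteq> q ` L" "(\<Sum>v\<in>t. single 0 (u v) * v) = 0" "\<exists>v\<in>t. u v \<noteq> 0"
    by (auto simp: dependent_explicit)
  define L' where "L' = {l \<in> L. q l \<in> t \<and> u (q l) \<noteq> 0}"
  have "(\<Sum>l\<in>L'. single 0 (u (q l)) * q l) = (\<Sum>v\<in>q ` L'. single 0 (u v) * v)"
    using True by (subst sum.reindex) (auto simp: L'_def inj_on_def)
  also have "\<dots> = (\<Sum>v\<in>t. single 0 (u v) * v)"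
    using t by (intro sum.mono_neutral_left) (auto simp: L'_def)
  finally have "(\<Sum>l\<in>L'. single 0 (u (q l)) * q l) = 0" using t by simp
  moreover have "L' \<noteq> {}" using t(2,4) by (auto simp: L'_def)
  ultimately show ?thesis
    using fin by (intro exI[of _ L'] exI[of _ "\<lambda>l. u (q l)"]) (auto simp: L'_def)
qed

definition box :: "'v set \<Rightarrow> nat \<Rightarrow> ('v \<Rightarrow>\<^sub>0 nat) set" where
  "box V n = {e. keys e \<subseteq> V \<and> (\<forall>v. lookup e v \<le> n)}"

lemma box_finite_card:
  fixes V :: "'v::finite set"
  shows "finite (box V n)" and "card (box V n) \<le> (n + 1) ^ card V"
proof -
  let ?f = "\<lambda>e. restrict (lookup e) V"
  have inj: "inj_on ?f (box V n)"
  proof (rule inj_onI, rule poly_mapping_eqI)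
    fix d e :: "'v \<Rightarrow>\<^sub>0 nat" and v assume *: "d \<in> box V n" "e \<in> box V n" "?f d = ?f e"
    show "lookup d v = lookup e v"
    proof (cases "v \<in> V")
      case True
      then show ?thesis using *(3) by (metis restrict_apply')
    next
      case False
      then have "v \<notin> keys d" "v \<notin> keys e" using * by (auto simp: box_def)
      then show ?thesis by (simp add: in_keys_iff)
    qed
  qed
  have sub: "?f ` box V n \<subseteq> (V \<rightarrow>\<^sub>E {..n})"
    by (auto simp: box_def)
  have fin: "finite (V \<rightarrow>\<^sub>E {..n})" by (simp add: finite_PiE)
  show "finite (box V n)" using inj_on_finite[OF inj sub fin] .
  have "card (box V n) \<le> card (V \<rightarrow>\<^sub>E {..n})" using card_inj_on_le[OF inj sub fin] .
  then show "card (box V n) \<le> (n + 1) ^ card V" by (simp add: card_PiE)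
qed

lemma box_mono: "m \<le> n \<Longrightarrow> box V m \<subseteq> box V n"
  by (auto simp: box_def intro: le_trans)

lemma keys_mult_box:
  assumes "keys p \<subseteq> box V m" "keys q \<subseteq> box V n"
  shows "keys (p * q) \<subseteq> box V (m + n)"
proof
  fix e assume "e \<in> keys (p * q)"
  then obtain a b where ab: "a \<in> box V m" "b \<in> box V n" "e = a + b"
    using assms by (blast elim: keys_multE)
  then show "e \<in> box V (m + n)"
    using keys_add[of a b] by (auto simp: box_def lookup_add intro: add_mono)
qed

lemma keys_one_box: "keys (1 :: ('v \<Rightarrow>\<^sub>0 nat) \<Rightarrow>\<^sub>0 'b::zero_neq_one) \<subseteq> box V n"
  by (auto simp: box_def)

lemma keys_power_box: "keys p \<subseteq> box V n \<Longrightarrow> keys (p ^ a) \<subseteq> box V (a * n)"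
proof (induction a)
  case (Suc a)
  then show ?case using keys_mult_box[of p V n "p ^ a" "a * n"] by simp
qed (simp only: power_0 keys_one_box)

lemma keys_power_prod_box:
  assumes "\<And>f. f \<in> set fs \<Longrightarrow> keys f \<subseteq> box V D" "\<And>a. a \<in> set l \<Longrightarrow> a \<le> N"
  shows "keys (power_prod fs l) \<subseteq> box V (length fs * (N * D))"
  using assms
proof (induction fs l rule: power_prod.induct)
  case (1 f fs a as)
  have "keys (f ^ a) \<subseteq> box V (a * D)" by (rule keys_power_box) (use 1 in auto)
  also have "\<dots> \<subseteq> box V (N * D)" using 1 by (intro box_mono mult_right_mono) auto
  finally have "keys (f ^ a * power_prod fs as) \<subseteq> box V (N * D + length fs * (N * D))"
    using 1 by (intro keys_mult_box) auto
  then show ?case by simp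
qed (simp_all only: power_prod.simps keys_one_box)

text \<open>There are \<open>(N + 1) ^ length fs\<close> products of powers with exponents at most \<open>N\<close>, but their
  monomials only range over \<open>O(N ^ card V)\<close> many exponent vectors.\<close>

lemma algebraic_dependence:
  fixes fs :: "('v::finite, 'k::field) mpoly list"
  assumes V: "\<And>f e. f \<in> set fs \<Longrightarrow> e \<in> keys f \<Longrightarrow> keys e \<subseteq> V" and card: "card V < length fs"
  shows "\<exists>L c. finite L \<and> L \<noteq> {} \<and> (\<forall>l\<in>L. length l = length fs \<and> c l \<noteq> 0) \<and>
    (\<Sum>l\<in>L. single 0 (c l) * power_prod fs l) = 0"
proof -
  \<comment> \<open>Bounds all exponents occurring in \<open>fs\<close>; the inserted
    \<open>0\<close> covers the case that all these polynomials are zero.\<close>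
  define D where "D = Max (insert 0 (\<Union>f\<in>set fs. \<Union>e\<in>keys f. range (lookup e)))"
  have D: "keys f \<subseteq> box V D" if "f \<in> set fs" for f
  proof
    fix e assume e: "e \<in> keys f"
    have "lookup e v \<le> D" for v
      unfolding D_def
    proof (rule Max_ge)
      show "finite (insert 0 (\<Union>f\<in>set fs. \<Union>e\<in>keys f. range (lookup e)))" by simp
      show "lookup e v \<in> insert 0 (\<Union>f\<in>set fs. \<Union>e\<in>keys f. range (lookup e))"
        using that e by blast
    qed
    then show "e \<in> box V D" using V[OF that e] by (auto simp: box_def)
  qed
  \<comment> \<open>With \<open>d = card V\<close>, this \<open>N\<close> turns
    \<open>(N + 1) ^ d * (k * D + 1) ^ d\<close> into \<open>(N + 1) ^ d * N\<close>, which is less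
    than \<open>(N + 1) ^ (d + 1)\<close> and hence less than the number of exponent lists, as
    \<open>d < k\<close>.\<close>
  define k N where "k = length fs" and "N = (k * D + 1) ^ card V"
  define L where "L = {l. set l \<subseteq> {..N} \<and> length l = k}"
  have L: "finite L" "card L = (N + 1) ^ k"
    unfolding L_def by (auto simp: card_lists_length_eq finite_lists_length_eq)
  have "card (box V (k * (N * D))) \<le> (k * (N * D) + 1) ^ card V" by (rule box_finite_card)
  also have "\<dots> \<le> ((N + 1) * (k * D + 1)) ^ card V"
    by (intro power_mono) (simp_all add: distrib_left distrib_right mult.left_commute)
  also have "\<dots> = (N + 1) ^ card V * N" unfolding power_mult_distrib N_def[symmetric] ..
  also have "\<dots> < (N + 1) ^ card V * (N + 1)" by simp
  also have "\<dots> = (N + 1) ^ Suc (card V)" by simp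
  also have "\<dots> \<le> (N + 1) ^ k" using card by (intro power_increasing) (auto simp: k_def)
  finally have lt: "card (box V (k * (N * D))) < card L" using L by simp
  have "keys (power_prod fs l) \<subseteq> box V (k * (N * D))" if "l \<in> L" for l
    unfolding k_def by (rule keys_power_prod_box) (use D that in \<open>auto simp: L_def\<close>)
  then have "\<exists>L' c. finite L' \<and> L' \<subseteq> L \<and> L' \<noteq> {} \<and> (\<forall>l\<in>L'. c l \<noteq> 0) \<and>
      (\<Sum>l\<in>L'. single 0 (c l) * power_prod fs l) = 0"
    by (intro linear_dependence[OF L(1) box_finite_card(1) lt])
  then obtain L' c where "finite L'" "L' \<subseteq> L" "L' \<noteq> {}" "\<forall>l\<in>L'. c l \<noteq> 0"
    "(\<Sum>l\<in>L'. single 0 (c l) * power_prod fs l) = 0" by (elim exE conjE)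
  moreover from \<open>L' \<subseteq> L\<close> have "length l = length fs" if "l \<in> L'" for l
    using that by (auto simp: L_def k_def)
  ultimately show ?thesis by (intro exI[of _ L'] exI[of _ c]) simp
qed

section \<open>Congruences modulo an ideal and the bound on chain lengths\<close>

lemma mult_cong_ideal:
  assumes Q: "is_ideal Q" and "a - a' \<in> Q" "b - b' \<in> Q"
  shows "a * b - a' * b' \<in> Q"
proof -
  have "a * b - a' * b' = b * (a - a') + a' * (b - b')" by (simp add: algebra_simps)
  then show ?thesis using assms by (auto intro!: ideal_add ideal_mult)
qed

lemma power_cong_ideal:
  assumes Q: "is_ideal Q" and "a - a' \<in> Q"
  shows "a ^ n - a' ^ n \<in> Q"
  by (induction n) (auto intro: ideal_zero[OF Q] mult_cong_ideal[OF Q assms(2)])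

lemma power_prod_cong_ideal:
  assumes Q: "is_ideal Q" and "list_all2 (\<lambda>f f'. f - f' \<in> Q) fs fs'"
  shows "power_prod fs l - power_prod fs' l \<in> Q"
  using assms(2)
proof (induction arbitrary: l rule: list_all2_induct)
  case Nil
  then show ?case using ideal_zero[OF Q] by simp
next
  case (Cons f fs f' fs')
  then show ?case
    using ideal_zero[OF Q] by (cases l) (auto intro: mult_cong_ideal power_cong_ideal Q)
qed

text \<open>The ideal generated by the variables in \<open>A\<close>, described through exponents so
  that membership can be read off from the monomials.\<close>

definition var_prime :: "'v set \<Rightarrow> ('v, 'k::field) mpoly set" where
  "var_prime A = {p. keys p \<subseteq> {e. keys e \<inter> A \<noteq> {}}}"

lemma upclosed_meets: "upclosed {e :: 'v \<Rightarrow>\<^sub>0 nat. keys e \<inter> A \<noteq> {}}"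
proof -
  have "keys e \<subseteq> keys (d + e)" for d e :: "'v \<Rightarrow>\<^sub>0 nat"
    by (auto simp: in_keys_iff lookup_add)
  then show ?thesis unfolding upclosed_def by blast
qed

lemma is_ideal_var_prime: "is_ideal (var_prime A)"
  unfolding var_prime_def by (intro is_ideal_keys_subset upclosed_meets)

lemma var_prime_subset:
  fixes Q :: "('v, 'k::field) mpoly set"
  assumes Q: "is_ideal Q" and "\<And>v. v \<in> A \<Longrightarrow> var v \<in> Q"
  shows "var_prime A \<subseteq> Q"
proof
  fix p :: "('v, 'k) mpoly" assume p: "p \<in> var_prime A"
  have "keys p \<subseteq> exps Q"
  proof
    fix e assume "e \<in> keys p"
    with p obtain v where v: "v \<in> keys e" "v \<in> A" by (auto simp: var_prime_def)
    then have "mdvd (single v 1) e"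
      by (auto simp: mdvd_def lookup_single when_def in_keys_iff)
    then obtain d where "e = single v 1 + d" by (auto simp: mdvd_iff)
    then have "(monom e :: ('v, 'k) mpoly) = var v * monom d" by (simp add: monom_add var_def)
    then show "e \<in> exps Q" using assms(2)[OF v(2)] ideal_mult'[OF Q] by (simp add: exps_def)
  qed
  then show "p \<in> Q" by (rule keys_subset_exps_imp[OF Q])
qed

text \<open>The elements become algebraically dependent modulo the variables that annihilate \<open>h\<close>.\<close>

theorem length_nzd_chain_le:
  fixes J :: "('v::finite, 'k::field) mpoly set"
  assumes chain: "nzd_chain J fs J'" and h: "h \<notin> J'" and A: "\<And>v. v \<in> A \<Longrightarrow> var v * h \<in> J"
  shows "length fs \<le> card (- A)"
proof (rule ccontr)
  assume "\<not> length fs \<le> card (- A)"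
  have J: "is_ideal J" using chain by (rule nzd_chain_is_ideal)
  \<comment> \<open>The colon ideal \<open>(J : h)\<close>. It contains the variables in
    \<open>A\<close>, so each element of \<open>fs\<close> is congruent modulo \<open>Q\<close> to a
    polynomial in the other variables.\<close>
  define Q where "Q = {p. p * h \<in> J}"
  have Q: "is_ideal Q"
    unfolding is_ideal_def Q_def
    by (auto simp: ideal_zero[OF J] distrib_right mult.assoc intro: ideal_add[OF J] ideal_mult[OF J])
  have AQ: "var_prime A \<subseteq> Q"
    using A by (intro var_prime_subset Q) (auto simp: Q_def)
  have "\<exists>f'. f - f' \<in> Q \<and> keys f' \<subseteq> {e. keys e \<subseteq> - A}" for f
  proof -
    obtain f' r where "f = f' + r" "keys f' \<subseteq> - {e. keys e \<inter> A \<noteq> {}}" "keys r \<subseteq> {e. keys e \<inter> A \<noteq> {}}"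
      by (rule ex_split_keys)
    then show ?thesis using AQ by (intro exI[of _ f']) (auto simp: var_prime_def)
  qed
  then obtain \<pi> where \<pi>: "\<And>f. f - \<pi> f \<in> Q" "\<And>f. keys (\<pi> f) \<subseteq> {e. keys e \<subseteq> - A}" by metis
  have "card (- A) < length (map \<pi> fs)" using \<open>\<not> length fs \<le> card (- A)\<close> by simp
  moreover have "keys e \<subseteq> - A" if "f \<in> set (map \<pi> fs)" "e \<in> keys f" for f e
    using \<pi>(2) that by fastforce
  ultimately obtain L c where L: "finite L" "L \<noteq> {}"
    "\<forall>l\<in>L. length l = length (map \<pi> fs) \<and> c l \<noteq> 0"
    and rel: "(\<Sum>l\<in>L. single 0 (c l) * power_prod (map \<pi> fs) l) = 0"
    using algebraic_dependence[of "map \<pi> fs" "- A"] by blast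
  have "power_prod fs l - power_prod (map \<pi> fs) l \<in> Q" for l
    using \<pi>(1) by (intro power_prod_cong_ideal Q) (simp add: list_all2_conv_all_nth)
  then have "(\<Sum>l\<in>L. single 0 (c l) * (power_prod fs l - power_prod (map \<pi> fs) l)) \<in> Q"
    by (intro ideal_sum Q ideal_mult)
  then have "(\<Sum>l\<in>L. single 0 (c l) * power_prod fs l) \<in> Q"
    using rel by (simp add: right_diff_distrib sum_subtractf)
  then have "(\<Sum>l\<in>L. single 0 (c l) * power_prod fs l * h) \<in> J"
    by (simp add: Q_def sum_distrib_right)
  then have "h \<in> J'"
    using L(3) by (intro nzd_chain_relation[OF chain L(1,2), of c]) auto
  with h show False ..
qed

section \<open>Prime ideals generated by variables\<close>

text \<open>Remove from both factors all terms divisible by a variable in \<open>A\<close>. The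
  product of the remaining parts has no such term either; if it lies in the ideal it is zero, and
  one of the parts vanishes.\<close>

lemma prime_var_prime: "prime_ideal (var_prime A :: ('v::finite, 'k::field) mpoly set)"
  unfolding prime_ideal_def
proof (intro conjI allI impI)
  show ideal: "is_ideal (var_prime A :: ('v, 'k) mpoly set)" by (rule is_ideal_var_prime)
  have "1 \<notin> (var_prime A :: ('v, 'k) mpoly set)" by (simp add: var_prime_def)
  then show "var_prime A \<noteq> (UNIV :: ('v, 'k) mpoly set)" by blast
  fix a b :: "('v, 'k) mpoly" assume ab: "a * b \<in> var_prime A"
  let ?M = "{e :: 'v \<Rightarrow>\<^sub>0 nat. keys e \<inter> A \<noteq> {}}"
  obtain a' r where a: "a = a' + r" "keys a' \<subseteq> - ?M" "keys r \<subseteq> ?M" by (rule ex_split_keys)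
  obtain b' s where b: "b = b' + s" "keys b' \<subseteq> - ?M" "keys s \<subseteq> ?M" by (rule ex_split_keys)
  have rs: "r \<in> var_prime A" "s \<in> var_prime A" using a b by (auto simp: var_prime_def)
  have "a * b - a' * b' \<in> var_prime A"
    by (rule mult_cong_ideal[OF ideal]) (use a b rs in auto)
  then have "a' * b' \<in> var_prime A"
    using ideal_cong[OF ideal] ab by blast
  moreover have "keys (a' * b') \<subseteq> - ?M"
  proof
    fix e assume "e \<in> keys (a' * b')"
    then obtain d d' where "d \<in> keys a'" "d' \<in> keys b'" "e = d + d'" by (rule keys_multE)
    then show "e \<in> - ?M" using a(2) b(2) keys_add[of d d'] by blast
  qed
  ultimately have "keys (a' * b') = {}" unfolding var_prime_def by blast
  then have "a' = 0 \<or> b' = 0" using poly_no_zero_divisors[of a' b'] by simp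
  then show "a \<in> var_prime A \<or> b \<in> var_prime A" using a b rs by auto
qed

lemma var_in_var_prime: "var v \<in> (var_prime A :: ('v, 'k::field) mpoly set) \<longleftrightarrow> v \<in> A"
  by (simp add: var_prime_def var_def)

lemma var_prime_strict_mono: "A \<subset> B \<Longrightarrow> (var_prime A :: ('v, 'k::field) mpoly set) \<subset> var_prime B"
proof -
  assume "A \<subset> B"
  then have "var_prime A \<subseteq> (var_prime B :: ('v, 'k) mpoly set)" by (auto simp: var_prime_def)
  moreover from \<open>A \<subset> B\<close> obtain v where "v \<in> B" "v \<notin> A" by auto
  then have "(var v :: ('v, 'k) mpoly) \<in> var_prime B - var_prime A" by (simp add: var_in_var_prime)
  ultimately show ?thesis by blast
qed

section \<open>Chains of primes, height and dimension\<close>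

lemma prime_chain_snoc:
  assumes "prime_chain Ps" "prime_ideal P" "last Ps \<subset> P"
  shows "prime_chain (Ps @ [P])"
  unfolding prime_chain_def
proof (intro conjI allI impI)
  fix i assume i: "Suc i < length (Ps @ [P])"
  show "(Ps @ [P]) ! i \<subset> (Ps @ [P]) ! Suc i"
  proof (cases "Suc i < length Ps")
    case True
    then show ?thesis using assms(1) by (simp add: nth_append prime_chain_def)
  next
    case False
    then have "i = length Ps - 1" "Ps \<noteq> []" "Suc i = length Ps"
      using i assms(1) by (auto simp: prime_chain_def)
    then show ?thesis using assms(3) by (simp add: nth_append last_conv_nth)
  qed
qed (use assms in \<open>auto simp: prime_chain_def\<close>)

lemma prime_chain_Cons:
  assumes "prime_chain Ps" "prime_ideal P" "P \<subset> hd Ps"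
  shows "prime_chain (P # Ps)"
  unfolding prime_chain_def
proof (intro conjI allI impI)
  fix i assume "Suc i < length (P # Ps)"
  then show "(P # Ps) ! i \<subset> (P # Ps) ! Suc i"
    using assms by (cases i) (auto simp: prime_chain_def hd_conv_nth)
qed (use assms in \<open>auto simp: prime_chain_def\<close>)

text \<open>An element outside a prime is a non-zero-divisor modulo it; one is chosen from each gap
  between consecutive primes.\<close>

lemma prime_chain_nzd_chain:
  "prime_chain Ps \<Longrightarrow> \<exists>fs. length fs = length Ps - 1 \<and> nzd_chain (hd Ps) fs (last Ps)"
proof (induction Ps rule: induct_list012)
  case 1
  then show ?case by (simp add: prime_chain_def)
next
  case (2 P)
  then show ?case by (auto simp: prime_chain_def prime_ideal_def intro: nzd_chain.Nil)
next
  case (3 P P' Ps)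
  have "prime_chain (P' # Ps)"
    using 3(3) unfolding prime_chain_def by force
  then obtain fs where fs: "length fs = length Ps" "nzd_chain P' fs (last (P' # Ps))"
    using 3(2) by auto
  have P: "prime_ideal P" "P \<subset> P'" using 3(3) by (force simp: prime_chain_def)+
  then obtain f where f: "f \<in> P'" "f \<notin> P" by auto
  then have "nzd_mod P f" using P(1) unfolding prime_ideal_def nzd_mod_def by blast
  then have "nzd_chain P (f # fs) (last (P' # Ps))"
    using P f fs(2) by (intro nzd_chain.Cons[of _ _ P']) (auto simp: prime_ideal_def)
  then show ?case using fs(1) by (intro exI[of _ "f # fs"]) auto
qed

text \<open>The bound for \<open>nzd_chain\<close> with \<open>h = 1\<close>, which lies outside the
  last prime.\<close>

lemma length_prime_chain_le:
  fixes Ps :: "('v::finite, 'k::field) mpoly set list"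
  assumes "prime_chain Ps" "\<And>v. v \<in> A \<Longrightarrow> var v \<in> hd Ps"
  shows "length Ps - 1 \<le> card (- A)"
proof -
  obtain fs where fs: "length fs = length Ps - 1" "nzd_chain (hd Ps) fs (last Ps)"
    using prime_chain_nzd_chain[OF assms(1)] by blast
  have "prime_ideal (last Ps)" using assms(1) by (simp add: prime_chain_def)
  then have "1 \<notin> last Ps" using ideal_eq_UNIV unfolding prime_ideal_def by blast
  from length_nzd_chain_le[OF fs(2) this, of A] assms(2) fs(1) show ?thesis by simp
qed

lemma height_le_card: "height (P :: ('v::finite, 'k::field) mpoly set) \<le> card (UNIV :: 'v set)"
  unfolding height_def
proof (rule Sup_least, clarify)
  fix Ps :: "('v, 'k) mpoly set list" assume "prime_chain Ps"
  from length_prime_chain_le[OF this, of "{}"] show "enat (length Ps - 1) \<le> card (UNIV :: 'v set)" by simp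
qed

lemma Sup_enat_mem:
  fixes X :: "enat set"
  assumes "X \<noteq> {}" "Sup X \<noteq> \<infinity>"
  shows "Sup X \<in> X"
  using assms Max_in[of X] by (auto simp: Sup_enat_def split: if_splits)

text \<open>The height of \<open>Q\<close> is finite, hence attained by a chain, and appending
  \<open>P\<close> lengthens this chain.\<close>

lemma height_strict_mono:
  fixes P Q :: "('v::finite, 'k::field) mpoly set"
  assumes "prime_ideal P" "prime_ideal Q" "Q \<subset> P"
  shows "height Q < height P"
proof -
  let ?H = "{enat (length Ps - 1) |Ps. prime_chain Ps \<and> last Ps = Q}"
  have "enat (length [Q] - 1) \<in> ?H"
    using assms(2) by (auto simp: prime_chain_def intro!: exI[of _ "[Q]"])
  moreover have "Sup ?H \<noteq> \<infinity>" using enat_ile[OF height_le_card[of Q]] by (auto simp: height_def)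
  ultimately have "height Q \<in> ?H" unfolding height_def by (intro Sup_enat_mem) blast+
  then obtain Ps where Ps: "height Q = enat (length Ps - 1)" "prime_chain Ps" "last Ps = Q" by auto
  then have "prime_chain (Ps @ [P])" using assms by (intro prime_chain_snoc) auto
  then have "enat (length (Ps @ [P]) - 1) \<le> height P"
    unfolding height_def by (intro Sup_upper) force
  moreover have "length Ps > 0" using Ps by (auto simp: prime_chain_def)
  then have "height Q < enat (length (Ps @ [P]) - 1)" unfolding Ps(1) by simp
  ultimately show ?thesis by simp
qed

text \<open>Appending \<open>var_prime (insert v A)\<close> lengthens the chain and enlarges
  \<open>A\<close> by one, which reduces the claim to \<open>A = UNIV\<close>. There the general
  bound by the number of variables applies.\<close>

lemma length_chain_to_var_prime_le:
  fixes Ps :: "('v::finite, 'k::field) mpoly set list"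
  assumes "prime_chain Ps" "last Ps = var_prime A"
  shows "length Ps - 1 \<le> card A"
  using assms
proof (induction "card (- A)" arbitrary: A Ps)
  case 0
  then have "A = UNIV" by auto
  then show ?case using length_prime_chain_le[OF 0(2), of "{}"] by simp
next
  case (Suc n)
  then obtain v where v: "v \<notin> A" by (metis Compl_iff card.empty equals0I nat.distinct(1))
  have "prime_chain (Ps @ [var_prime (insert v A)])"
    using Suc.prems v by (intro prime_chain_snoc prime_var_prime) (auto intro!: var_prime_strict_mono)
  moreover have "n = card (- insert v A)"
    using Suc.hyps(2) v by (simp add: Compl_insert)
  ultimately have "length (Ps @ [var_prime (insert v A) :: ('v, 'k) mpoly set]) - 1 \<le> card (insert v A)"
    by (intro Suc.hyps(1)) auto
  then show ?case using v by simp
qed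

lemma chain_to_var_prime:
  fixes A :: "'v::finite set"
  shows "\<exists>Ps. prime_chain Ps \<and> last Ps = (var_prime A :: ('v, 'k::field) mpoly set) \<and> length Ps = card A + 1"
  using finite[of A]
proof (induction A rule: finite_induct)
  case empty
  show ?case using prime_var_prime[of "{}"] by (intro exI[of _ "[var_prime {}]"]) (auto simp: prime_chain_def)
next
  case (insert v A)
  then obtain Ps where Ps: "prime_chain Ps" "last Ps = (var_prime A :: ('v, 'k) mpoly set)" "length Ps = card A + 1"
    by blast
  then have "prime_chain (Ps @ [var_prime (insert v A)])"
    using insert by (intro prime_chain_snoc prime_var_prime) (auto intro!: var_prime_strict_mono)
  then show ?case using Ps insert by (intro exI[of _ "Ps @ [var_prime (insert v A)]"]) auto
qed

lemma chain_from_var_prime: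
  fixes A :: "'v::finite set"
  shows "\<exists>Ps. prime_chain Ps \<and> hd Ps = (var_prime A :: ('v, 'k::field) mpoly set) \<and> length Ps = card (- A) + 1"
proof (induction "card (- A)" arbitrary: A)
  case 0
  show ?case
    using prime_var_prime[of A] 0 by (intro exI[of _ "[var_prime A]"]) (auto simp: prime_chain_def)
next
  case (Suc n)
  then obtain v where v: "v \<notin> A" by (metis Compl_iff card.empty equals0I nat.distinct(1))
  then have n: "n = card (- insert v A)"
    using Suc.hyps(2) by (simp add: Compl_insert)
  then obtain Ps where Ps: "prime_chain Ps" "hd Ps = (var_prime (insert v A) :: ('v, 'k) mpoly set)"
    "length Ps = n + 1" using Suc.hyps(1)[OF n] by auto
  have "prime_chain (var_prime A # Ps)"
    using Ps v by (intro prime_chain_Cons prime_var_prime) (auto intro!: var_prime_strict_mono)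
  then show ?case using Ps Suc.hyps(2) by (intro exI[of _ "var_prime A # Ps"]) auto
qed

lemma height_var_prime: "height (var_prime A :: ('v::finite, 'k::field) mpoly set) = enat (card A)"
proof (rule antisym)
  show "height (var_prime A :: ('v, 'k) mpoly set) \<le> enat (card A)"
    unfolding height_def by (rule Sup_least) (auto dest: length_chain_to_var_prime_le)
  obtain Ps where "prime_chain Ps" "last Ps = (var_prime A :: ('v, 'k) mpoly set)" "length Ps = card A + 1"
    using chain_to_var_prime by blast
  then show "enat (card A) \<le> height (var_prime A :: ('v, 'k) mpoly set)"
    unfolding height_def by (intro Sup_upper) force
qed

lemma krull_dim_quot_ge:
  assumes "I \<subseteq> (var_prime A :: ('v::finite, 'k::field) mpoly set)"
  shows "enat (card (- A)) \<le> krull_dim_quot I"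
proof -
  obtain Ps where "prime_chain Ps" "hd Ps = (var_prime A :: ('v, 'k) mpoly set)" "length Ps = card (- A) + 1"
    using chain_from_var_prime by blast
  then show ?thesis using assms unfolding krull_dim_quot_def by (intro Sup_upper) force
qed

lemma krull_dim_quot_le:
  fixes I :: "('v::finite, 'k::field) mpoly set"
  assumes "\<And>P. prime_ideal P \<Longrightarrow> I \<subseteq> P \<Longrightarrow> \<exists>A. (\<forall>v\<in>A. var v \<in> P) \<and> card (- A) \<le> d"
  shows "krull_dim_quot I \<le> enat d"
  unfolding krull_dim_quot_def
proof (rule Sup_least, clarify)
  fix Ps :: "('v, 'k) mpoly set list" assume Ps: "prime_chain Ps" "I \<subseteq> hd Ps"
  then have "prime_ideal (hd Ps)" by (simp add: prime_chain_def)
  with assms Ps obtain A where A: "\<forall>v\<in>A. var v \<in> hd Ps" "card (- A) \<le> d" by blast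
  then have "length Ps - 1 \<le> card (- A)" using length_prime_chain_le[OF Ps(1)] by blast
  then show "enat (length Ps - 1) \<le> enat d" using A(2) by simp
qed

section \<open>Regular sequences in the irrelevant ideal and the bound on depth\<close>

lemma regular_seq_iff:
  assumes "is_ideal I"
  shows "regular_seq I fs \<longleftrightarrow> set fs \<subseteq> irrelevant \<and> foldl adjoin I fs \<noteq> UNIV \<and> weakly_regular I fs"
  unfolding regular_seq_def weakly_regular_iff[OF assms] nzd_mod_def ideal_gen_Un_list[OF assms, of fs]
  by blast

lemma var_in_irrelevant: "var v \<in> (irrelevant :: ('v, 'k::field) mpoly set)"
  using ideal_gen_superset[of "range var"] by (auto simp: irrelevant_def)

lemma degree_irrelevant:
  fixes f :: "('v::finite, 'k::field) mpoly"
  assumes "f \<in> irrelevant" "e \<in> keys f"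
  shows "1 \<le> degree e"
proof -
  have "upclosed {e :: 'v \<Rightarrow>\<^sub>0 nat. 1 \<le> degree e}" by (auto simp: upclosed_def degree_add)
  then have "irrelevant \<subseteq> {p :: ('v, 'k) mpoly. keys p \<subseteq> {e. 1 \<le> degree e}}"
    unfolding irrelevant_def
    by (intro ideal_gen_least is_ideal_keys_subset) (auto simp: var_def)
  with assms show ?thesis by blast
qed

lemma degree_irrelevant_power:
  fixes f :: "('v::finite, 'k::field) mpoly"
  assumes "f \<in> irrelevant" "e \<in> keys (f ^ n)"
  shows "n \<le> degree e"
  using assms(2)
proof (induction n arbitrary: e)
  case (Suc n)
  then obtain a b where "a \<in> keys f" "b \<in> keys (f ^ n)" "e = a + b" by (auto elim: keys_multE)
  then show ?case using Suc.IH[of b] degree_irrelevant[OF assms(1), of a] by (simp add: degree_add)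
qed simp

text \<open>Replacing a regular sequence by its \<open>D\<close>-th powers keeps it regular, and for \<open>D > degree h\<close>
  the ideal it generates together with \<open>I\<close> cannot contain the monomial \<open>h\<close>.\<close>

lemma depth_quot_le:
  fixes I :: "('v::finite, 'k::field) mpoly set"
  assumes I: "monomial_ideal I" and h: "h \<notin> exps I"
    and A: "\<And>v. v \<in> A \<Longrightarrow> single v 1 + h \<in> exps I"
  shows "depth_quot I \<le> enat (card (- A))"
  unfolding depth_quot_def
proof (rule Sup_least, clarify)
  fix fs :: "('v, 'k) mpoly list" assume fs: "regular_seq I fs"
  have ideal: "is_ideal I" using I by (simp add: monomial_ideal_def)
  define D where "D = degree h + 1"
  define gs where "gs = map (\<lambda>f. f ^ D) fs"
  have "weakly_regular I gs"
    using fs regular_seq_iff[OF ideal] weakly_regular_powers[OF ideal] by (auto simp: gs_def)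
  then have chain: "nzd_chain I gs (foldl adjoin I gs)" by (rule weakly_regular_nzd_chain[OF ideal])
  \<comment> \<open>Upward closed, and containing the exponents of \<open>I\<close> and of all
    \<open>gs\<close> but not \<open>h\<close>; so the ideal they generate misses
    \<open>monom h\<close>.\<close>
  define M where "M = exps I \<union> {e. D \<le> degree e}"
  have "upclosed M"
    using upclosed_exps[OF ideal] by (auto simp: M_def upclosed_def degree_add)
  moreover have "I \<union> set gs \<subseteq> {p. keys p \<subseteq> M}"
    using monomial_ideal_iff[OF I] fs degree_irrelevant_power
    by (fastforce simp: M_def gs_def regular_seq_def)
  ultimately have "ideal_gen (I \<union> set gs) \<subseteq> {p. keys p \<subseteq> M}"
    by (intro ideal_gen_least is_ideal_keys_subset)
  then have "monom h \<notin> foldl adjoin I gs"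
    using h by (auto simp: ideal_gen_Un_list[OF ideal] M_def D_def)
  from length_nzd_chain_le[OF chain this, of A] A
  have "length gs \<le> card (- A)" by (auto simp: exps_def var_def monom_add)
  then show "enat (length fs) \<le> enat (card (- A))" by (simp add: gs_def)
qed

section \<open>Non-zero-divisors modulo monomial ideals\<close>

text \<open>Among the monomials of \<open>p\<close> outside \<open>M\<close> that agree off \<open>x\<close> and \<open>y\<close>, look at one with largest
  exponent of \<open>y\<close> and at one with largest exponent of \<open>x\<close>: no cancellation occurs there.\<close>

lemma nzd_mod_var_diff:
  fixes x y :: 'v
  assumes M: "upclosed M" and xy: "x \<noteq> y"
    and y: "\<And>e. e \<notin> M \<Longrightarrow> single y 1 + e \<in> M \<Longrightarrow> w \<le> lookup e x"
    and x: "\<And>e. e \<notin> M \<Longrightarrow> w \<le> lookup e x \<Longrightarrow> single x 1 + e \<notin> M"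
  shows "nzd_mod {p :: ('v, 'k::field) mpoly. keys p \<subseteq> M} (var y - var x)"
  unfolding nzd_mod_def mem_Collect_eq
proof (intro allI impI, rule ccontr)
  fix p :: "('v, 'k) mpoly"
  assume p: "keys ((var y - var x) * p) \<subseteq> M" and "\<not> keys p \<subseteq> M"
  then obtain e0 where e0: "e0 \<in> keys p" "e0 \<notin> M" by blast
  define T where "T = {e \<in> keys p - M. \<forall>v. v \<noteq> x \<longrightarrow> v \<noteq> y \<longrightarrow> lookup e v = lookup e0 v}"
  have T: "finite T" "e0 \<in> T" using e0 by (auto simp: T_def)
  \<comment> \<open>If \<open>var u\<close> times the monomial \<open>e\<close> stays outside
    \<open>M\<close>, that term of the product must cancel. Its partner is \<open>var v\<close>
    times some \<open>d\<close> in \<open>T\<close>, and \<open>d\<close> has a larger exponent of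
    \<open>u\<close>.\<close>
  have swap: "\<exists>d\<in>T. lookup e u < lookup d u"
    if e: "e \<in> T" "single u 1 + e \<notin> M" and u: "u = x \<and> v = y \<or> u = y \<and> v = x" for e u v
  proof -
    have uv: "u \<noteq> v" using u xy by auto
    have "keys ((var u - var v) * p) \<subseteq> M"
      using u
    proof
      assume "u = x \<and> v = y"
      then have "(var u - var v) * p = - ((var y - var x) * p)" by (simp add: algebra_simps)
      then show ?thesis using p by simp
    qed (use p in auto)
    then have "lookup ((var u - var v) * p) (single u 1 + e) = 0"
      using e(2) by (auto simp: in_keys_iff)
    moreover have "lookup (var u * p) (single u 1 + e) = lookup p e"
      using lookup_single_mult[of "single u 1" 1 p e] by (simp add: var_def monom_def)
    ultimately have "lookup (var v * p) (single u 1 + e) = lookup p e"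
      by (simp add: left_diff_distrib lookup_minus)
    moreover have "lookup p e \<noteq> 0" using e(1) by (auto simp: T_def in_keys_iff)
    ultimately have "single u 1 + e \<in> keys (var v * p)" by (simp add: in_keys_iff)
    then obtain d where d: "d \<in> keys p" "single u 1 + e = single v 1 + d"
      by (auto simp: var_def keys_monom_mult)
    have "d \<notin> M" using upclosedD(1)[OF M, of d "single v 1"] d(2) e(2) by auto
    have "lookup (single u 1 + e) z = lookup (single v 1 + d) z" for z using d(2) by simp
    then have *: "(1 when u = z) + lookup e z = (1 when v = z) + lookup d z" for z
      by (simp add: lookup_add lookup_single)
    have "d \<in> T"
      unfolding T_def
    proof (intro CollectI conjI allI impI)
      fix z assume "z \<noteq> x" "z \<noteq> y"
      then show "lookup d z = lookup e0 z" using *[of z] u e(1) by (auto simp: T_def)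
    qed (use d(1) \<open>d \<notin> M\<close> in auto)
    moreover have "lookup e u < lookup d u" using *[of u] uv by simp
    ultimately show ?thesis by blast
  qed
  obtain e where e: "e \<in> T" "\<And>d. d \<in> T \<Longrightarrow> lookup d y \<le> lookup e y"
    using ex_has_greatest_nat[of "\<lambda>e. e \<in> T" e0 "\<lambda>e. lookup e y" "Suc (Max ((\<lambda>e. lookup e y) ` T))"] T
    by (auto simp: less_Suc_eq_le)
  obtain e' where e': "e' \<in> T" "\<And>d. d \<in> T \<Longrightarrow> lookup d x \<le> lookup e' x"
    using ex_has_greatest_nat[of "\<lambda>e. e \<in> T" e0 "\<lambda>e. lookup e x" "Suc (Max ((\<lambda>e. lookup e x) ` T))"] T
    by (auto simp: less_Suc_eq_le)
  \<comment> \<open>By maximality, multiplication by \<open>y\<close> sends \<open>e\<close> into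
    \<open>M\<close>, so the exponent of \<open>x\<close> in \<open>e\<close> is at least
    \<open>w\<close>. The same then holds for \<open>e'\<close>; so multiplication by
    \<open>x\<close> keeps \<open>e'\<close> outside \<open>M\<close>, and \<open>swap\<close>
    contradicts the choice of \<open>e'\<close>.\<close>
  have "single y 1 + e \<in> M" using swap[OF e(1), of y x] e(2) by (meson not_le)
  then have "w \<le> lookup e x" using y[of e] e(1) by (auto simp: T_def)
  also have "\<dots> \<le> lookup e' x" using e'(2) e(1) by blast
  finally have "single x 1 + e' \<notin> M" using x[of e'] e'(1) by (auto simp: T_def)
  then show False using swap[OF e'(1), of x y] e'(2) by (meson not_le)
qed

lemma prime_ideal_monom:
  assumes P: "prime_ideal P" and "monom e \<in> P"
  shows "\<exists>v\<in>keys e. var v \<in> P"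
  using assms(2)
proof (induction e rule: exponent_induct)
  case zero
  then show ?case using P ideal_eq_UNIV by (auto simp: monom_zero prime_ideal_def)
next
  case (step e a)
  then have "monom e \<in> P \<or> var a \<in> P"
    using P by (auto simp: monom_add var_def prime_ideal_def)
  moreover have "keys (e + single a 1) = insert a (keys e)"
    by (auto simp: in_keys_iff lookup_add lookup_single when_def split: if_splits)
  ultimately show ?case using step.IH by auto
qed

section \<open>Associated primes of monomial ideals\<close>

text \<open>If \<open>N\<close> bounds all exponents of the minimal generators, adding
  \<open>big N V\<close> to \<open>h\<close> tests whether \<open>h\<close> enters \<open>I\<close>
  once the variables in \<open>V\<close> are inverted.\<close>

definition big :: "nat \<Rightarrow> 'v::finite set \<Rightarrow> ('v \<Rightarrow>\<^sub>0 nat)" where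
  "big N V = (\<Sum>v\<in>V. single v N)"

lemma lookup_big: "lookup (big N V) v = (N when v \<in> V)"
  unfolding big_def lookup_sum lookup_single by (simp add: when_def)

text \<open>If \<open>V\<close> is maximal such that inverting its variables keeps \<open>h\<close> outside \<open>I\<close>, then a maximal
  multiple of \<open>h\<close> in the remaining variables has annihilator \<open>var_prime (- V)\<close>.\<close>

lemma ass_var_prime:
  fixes I :: "('v::finite, 'k::field) mpoly set"
  assumes I: "monomial_ideal I" and N: "\<And>g v. g \<in> min_gens I \<Longrightarrow> lookup g v \<le> N"
    and V: "big N V + h \<notin> exps I" "\<And>v. v \<notin> V \<Longrightarrow> big N (insert v V) + h \<in> exps I"
  shows "\<exists>h'. h' \<notin> exps I \<and> (\<forall>v\<in>- V. single v 1 + h' \<in> exps I)"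
    and "var_prime (- V) \<in> ass I"
proof -
  have ideal: "is_ideal I" using I by (simp add: monomial_ideal_def)
  note up = upclosedD[OF upclosed_exps[OF ideal]]
  let ?P = "\<lambda>n. keys n \<subseteq> - V \<and> n + (big N V + h) \<notin> exps I"
  \<comment> \<open>An exponent above \<open>N\<close> at \<open>v\<close> would make
    \<open>n + (big N V + h)\<close> a multiple of \<open>big N (insert v V) + h\<close>, which lies
    in \<open>exps I\<close>. So a multiplier \<open>n\<close> of largest degree exists.\<close>
  have bound: "degree n < Suc (card (UNIV :: 'v set) * N)" if n: "?P n" for n
  proof -
    have "lookup n v \<le> N" for v
    proof (rule ccontr)
      assume "\<not> lookup n v \<le> N"
      then have v: "N < lookup n v" by simp
      then have "v \<in> keys n" by (simp add: in_keys_iff)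
      then have "v \<notin> V" using n by blast
      have "mdvd (big N (insert v V) + h) (n + (big N V + h))"
        using v \<open>v \<notin> V\<close> by (auto simp: mdvd_def lookup_add lookup_big when_def)
      then have "n + (big N V + h) \<in> exps I" using up V(2)[OF \<open>v \<notin> V\<close>] by (auto simp: mdvd_iff)
      with n show False by blast
    qed
    then have "degree n \<le> (\<Sum>v\<in>(UNIV :: 'v set). N)" unfolding degree_eq by (intro sum_mono)
    then show ?thesis by simp
  qed
  have "?P 0" using V(1) by simp
  from ex_has_greatest_nat[of ?P, OF this, of degree "Suc (card (UNIV :: 'v set) * N)"] bound
  obtain n where n: "?P n" "\<And>n'. ?P n' \<Longrightarrow> degree n' \<le> degree n" by blast
  define h' where "h' = n + (big N V + h)"
  have kill: "single v 1 + h' \<in> exps I" if "v \<notin> V" for v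
  proof (rule ccontr)
    assume "single v 1 + h' \<notin> exps I"
    moreover have "keys (single v 1 + n) \<subseteq> - V"
      using keys_add[of "single v 1" n] n(1) that by auto
    ultimately have "?P (single v 1 + n)" by (simp add: h'_def add.assoc)
    from n(2)[OF this] show False by (simp add: degree_add)
  qed
  \<comment> \<open>On \<open>V\<close> the exponents of \<open>h'\<close> are already at least
    \<open>N\<close>, so multiplying by variables in \<open>V\<close> lets no new minimal generator
    divide.\<close>
  have keep: "d + h' \<notin> exps I" if "keys d \<subseteq> V" for d
  proof
    assume "d + h' \<in> exps I"
    then obtain g where g: "g \<in> min_gens I" "mdvd g (d + h')" using ex_min_gen by blast
    have "lookup g v \<le> lookup h' v" for v
    proof (cases "v \<in> V")
      case True
      then show ?thesis using N[OF g(1), of v] by (simp add: h'_def lookup_add lookup_big)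
    next
      case False
      then have "lookup d v = 0" using that by (auto simp: in_keys_iff)
      then show ?thesis using g(2) by (metis add_0 lookup_add mdvd_def)
    qed
    then have "h' \<in> exps I" using g(1) exps_iff[OF ideal] by (auto simp: mdvd_def)
    then show False using n(1) by (simp add: h'_def)
  qed
  show "\<exists>h'. h' \<notin> exps I \<and> (\<forall>v\<in>- V. single v 1 + h' \<in> exps I)"
    using kill keep[of 0] by (intro exI[of _ h']) auto
  have iff: "h' + e \<in> exps I \<longleftrightarrow> keys e \<inter> - V \<noteq> {}" for e
  proof
    assume "keys e \<inter> - V \<noteq> {}"
    then obtain v where v: "v \<in> keys e" "v \<notin> V" by auto
    then have "mdvd (single v 1 + h') (h' + e)"
      by (auto simp: mdvd_def lookup_add lookup_single when_def in_keys_iff)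
    then show "h' + e \<in> exps I" using up kill[OF v(2)] by (auto simp: mdvd_iff)
  qed (use keep[of e] in \<open>auto simp: add.commute\<close>)
  have "p * monom h' \<in> I \<longleftrightarrow> p \<in> var_prime (- V)" for p
  proof -
    have "p * monom h' \<in> I \<longleftrightarrow> keys (monom h' * p) \<subseteq> exps I"
      by (simp add: monomial_ideal_iff[OF I] mult.commute)
    also have "\<dots> \<longleftrightarrow> (\<forall>e\<in>keys p. h' + e \<in> exps I)" unfolding keys_monom_mult by blast
    also have "\<dots> \<longleftrightarrow> p \<in> var_prime (- V)" unfolding iff var_prime_def by blast
    finally show ?thesis .
  qed
  then show "var_prime (- V) \<in> ass I"
    unfolding ass_def using prime_var_prime[of "- V"] by blast
qed

lemma ex_maximal_big:
  assumes "big N U + h \<notin> M"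
  shows "\<exists>V. U \<subseteq> V \<and> big N V + h \<notin> M \<and> (\<forall>v. v \<notin> V \<longrightarrow> big N (insert v V) + h \<in> M)"
proof -
  let ?P = "\<lambda>V. U \<subseteq> V \<and> big N V + h \<notin> M"
  have "?P U" using assms by simp
  from ex_has_greatest_nat[of ?P, OF this, of card "Suc (card (UNIV :: 'a set))"]
  obtain V where V: "?P V" "\<And>W. ?P W \<Longrightarrow> card W \<le> card V"
    by (auto simp: less_Suc_eq_le card_mono)
  have "big N (insert v V) + h \<in> M" if "v \<notin> V" for v
  proof (rule ccontr)
    assume "big N (insert v V) + h \<notin> M"
    then have "card (insert v V) \<le> card V" using V(1) by (intro V(2)) auto
    then show False using that by simp
  qed
  with V(1) show ?thesis by blast
qed

section \<open>Whiskered graphs\<close>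

text \<open>This substitution realises the quotient by the differences of \<open>Inr i\<close> and
  \<open>Inl i\<close> for \<open>i\<close> in \<open>B\<close>.\<close>

fun merge :: "'a set \<Rightarrow> 'a + 'a \<Rightarrow> 'a + 'a" where
  "merge B (Inl i) = Inl i"
| "merge B (Inr i) = (if i \<in> B then Inl i else Inr i)"

locale whiskered_ideal =
  fixes I :: "('a::finite + 'a, 'k::field) mpoly set" and E :: "'a set set"
  assumes H_simple: "\<forall>e\<in>E. card e = 2"
    and supp2: "support2 I"
    and whisker: "graph_edges I = (\<lambda>e. Inl ` e) ` E \<union> {{Inl i, Inr i} | i. True}"
begin

lemma mono_I: "monomial_ideal I" and ideal_I: "is_ideal I"
  using supp2 by (auto simp: support2_def monomial_ideal_def)

lemmas mem_I_iff = monomial_ideal_iff[OF mono_I]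

lemma keys_min_gen_cases:
  assumes "g \<in> min_gens I"
  obtains (whisker_edge) i where "keys g = {Inl i, Inr i}"
  | (graph_edge) i j where "i \<noteq> j" "{i, j} \<in> E" "keys g = {Inl i, Inl j}"
proof -
  have "keys g \<in> (\<lambda>e. Inl ` e) ` E \<union> {{Inl i, Inr i} | i. True}"
    unfolding whisker[symmetric] graph_edges_def using assms by (rule imageI)
  then show ?thesis
  proof
    assume "keys g \<in> (\<lambda>e. Inl ` e) ` E"
    then obtain e where e: "e \<in> E" "keys g = Inl ` e" by auto
    then obtain i j where "e = {i, j}" "i \<noteq> j" using H_simple by (meson card_2_iff)
    then show ?thesis using e that(2)[of i j] by auto
  qed (use that(1) in auto)
qed

lemma ex_min_gen_whisker: "\<exists>g\<in>min_gens I. keys g = {Inl i, Inr i}"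
proof -
  have "{Inl i, Inr i} \<in> keys ` min_gens I" using whisker unfolding graph_edges_def by blast
  then show ?thesis by (auto simp: image_iff)
qed

lemma ex_min_gen_edge:
  assumes "{i, j} \<in> E"
  shows "\<exists>g\<in>min_gens I. keys g = {Inl i, Inl j}"
proof -
  have "Inl ` {i, j} \<in> keys ` min_gens I" using whisker assms unfolding graph_edges_def by blast
  then show ?thesis by (auto simp: image_iff)
qed

lemma min_gen_Inr:
  assumes "g \<in> min_gens I" "Inr i \<in> keys g"
  shows "keys g = {Inl i, Inr i}"
  using assms by (cases rule: keys_min_gen_cases) auto

lemma min_gen_Inl: "g \<in> min_gens I \<Longrightarrow> \<exists>i. Inl i \<in> keys g"
  by (erule keys_min_gen_cases) auto

lemma card_keys_min_gen: "g \<in> min_gens I \<Longrightarrow> card (keys g) = 2"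
  using supp2 by (simp add: support2_def)

lemma min_gens_pair_eq:
  assumes "g \<in> min_gens I" "g' \<in> min_gens I" "keys g = {u, v}"
    and "lookup g u \<le> lookup g' u" "lookup g v \<le> lookup g' v"
  shows "g = g'"
proof -
  have "lookup g z \<le> lookup g' z" for z
  proof (cases "z \<in> {u, v}")
    case False
    then have "z \<notin> keys g" using assms(3) by simp
    then show ?thesis by (simp add: in_keys_iff)
  qed (use assms in auto)
  then show ?thesis using min_gens_antichain[OF assms(1,2)] by (simp add: mdvd_def)
qed

text \<open>On a fixed edge the antichain property lets one exponent determine the generator, and
  every generator other than \<open>g0\<close> has a smaller exponent than \<open>g0\<close> at one
  of the two vertices.\<close>

lemma finite_min_gens: "finite (min_gens I)"
proof -
  have pair: "finite {g \<in> min_gens I. keys g = {u, v}}" for u v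
  proof (cases "{g \<in> min_gens I. keys g = {u, v}} = {}")
    case False
    then obtain g0 where g0: "g0 \<in> min_gens I" "keys g0 = {u, v}" by auto
    have inj: "inj_on (\<lambda>g. lookup g u) {g \<in> min_gens I. keys g = {u, v}}" for u v
    proof (rule inj_onI)
      fix g g' assume "g \<in> {g \<in> min_gens I. keys g = {u, v}}" "g' \<in> {g \<in> min_gens I. keys g = {u, v}}"
        "lookup g u = lookup g' u"
      then show "g = g'"
        using min_gens_pair_eq[of g g' u v] min_gens_pair_eq[of g' g u v] nat_le_linear[of "lookup g v" "lookup g' v"]
        by auto
    qed
    have small: "finite {g \<in> min_gens I. keys g = {u, v} \<and> lookup g u < n}" for u v n
      by (rule inj_on_finite[OF inj_on_subset[OF inj[of u v]], of _ "{..<n}"]) auto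
    have "{g \<in> min_gens I. keys g = {u, v}} \<subseteq> insert g0
      ({g \<in> min_gens I. keys g = {u, v} \<and> lookup g u < lookup g0 u} \<union>
       {g \<in> min_gens I. keys g = {v, u} \<and> lookup g v < lookup g0 v})"
    proof
      fix g assume "g \<in> {g \<in> min_gens I. keys g = {u, v}}"
      then show "g \<in> insert g0
      ({g \<in> min_gens I. keys g = {u, v} \<and> lookup g u < lookup g0 u} \<union>
       {g \<in> min_gens I. keys g = {v, u} \<and> lookup g v < lookup g0 v})"
        using min_gens_pair_eq[OF g0(1) _ g0(2), of g] by (auto simp: insert_commute not_less[symmetric])
    qed
    then show ?thesis using small by (meson finite_Un finite_insert finite_subset)
  next
    case True
    then show ?thesis by (simp only: finite.emptyI)
  qed
  have "min_gens I \<subseteq> (\<Union>u. \<Union>v. {g \<in> min_gens I. keys g = {u, v}})"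
    using card_keys_min_gen by (fastforce simp: card_2_iff)
  then show ?thesis by (rule finite_subset) (intro finite_UN_I finite pair)
qed

lemma min_gens_bound: "\<exists>N. \<forall>g\<in>min_gens I. \<forall>v. lookup g v \<le> N"
proof -
  let ?X = "insert 0 (\<Union>g\<in>min_gens I. range (lookup g))"
  have "finite ?X" using finite_min_gens by simp
  then have "lookup g v \<le> Max ?X" if "g \<in> min_gens I" for g v
    using that by (intro Max_ge) auto
  then show ?thesis by blast
qed

text \<open>Free of \<open>alpha\<close> and \<open>mu\<close>. Since \<open>g'\<close> ranges over
  all minimal generators, including those on the same whisker edge, uniqueness there is encoded
  too.\<close>

definition whisker_dominant :: bool where
  "whisker_dominant \<longleftrightarrow> (\<forall>i. \<forall>g\<in>min_gens I. \<forall>g'\<in>min_gens I.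
     keys g = {Inl i, Inr i} \<longrightarrow> lookup g' (Inl i) \<le> lookup g (Inl i))"

text \<open>Dominance in both directions gives equal exponents of \<open>Inl i\<close>; comparing
  those of \<open>Inr i\<close>, one generator divides the other.\<close>

lemma whisker_unique:
  assumes whisker_dominant "g \<in> min_gens I" "g' \<in> min_gens I"
    "keys g = {Inl i, Inr i}" "keys g' = {Inl i, Inr i}"
  shows "g = g'"
proof -
  have "lookup g (Inl i) = lookup g' (Inl i)"
    using assms unfolding whisker_dominant_def by (meson order_antisym)
  then show ?thesis
    using min_gens_pair_eq[OF assms(2,3,4)] min_gens_pair_eq[OF assms(3,2,5)]
      nat_le_linear[of "lookup g (Inr i)" "lookup g' (Inr i)"] by auto
qed

lemma mu_eq_Max: "mu I u v = Max ((\<lambda>g. lookup g u) ` {g \<in> min_gens I. keys g = {u, v}})"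
  unfolding mu_def by (rule arg_cong[of _ _ Max]) auto

text \<open>Each maximum runs over a finite nonempty set, as every edge carries a generator. A
  generator involving \<open>Inl i\<close> lies either on the whisker edge, where counting
  identifies it with \<open>g\<close>, or on an edge of \<open>E\<close>, where \<open>mu\<close>
  bounds it.\<close>

lemma whisker_dominant_iff:
  "whisker_dominant \<longleftrightarrow> (\<forall>i. alpha I (Inl i) (Inr i) = 1 \<and>
     (\<forall>j. {i, j} \<in> E \<longrightarrow> mu I (Inl i) (Inr i) \<ge> mu I (Inl i) (Inl j)))"
  (is "_ \<longleftrightarrow> (\<forall>i. ?C i)")
proof
  assume dom: whisker_dominant
  show "\<forall>i. ?C i"
  proof
    fix i
    obtain g where g: "g \<in> min_gens I" "keys g = {Inl i, Inr i}" using ex_min_gen_whisker by blast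
    then have eq: "{g \<in> min_gens I. keys g = {Inl i, Inr i}} = {g}"
      using whisker_unique[OF dom] by blast
    have "mu I (Inl i) (Inl j) \<le> mu I (Inl i) (Inr i)" if "{i, j} \<in> E" for j
    proof -
      have "mu I (Inl i) (Inl j) \<le> lookup g (Inl i)"
        unfolding mu_eq_Max
      proof (rule Max.boundedI)
        show "finite ((\<lambda>g. lookup g (Inl i)) ` {g \<in> min_gens I. keys g = {Inl i, Inl j}})"
          using finite_min_gens by simp
        show "(\<lambda>g. lookup g (Inl i)) ` {g \<in> min_gens I. keys g = {Inl i, Inl j}} \<noteq> {}"
          using ex_min_gen_edge[OF that] by blast
      qed (use dom g in \<open>auto simp: whisker_dominant_def\<close>)
      also have "\<dots> = mu I (Inl i) (Inr i)" unfolding mu_eq_Max eq by simp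
      finally show ?thesis .
    qed
    then show "?C i" by (simp add: alpha_def eq)
  qed
next
  assume C: "\<forall>i. ?C i"
  show whisker_dominant
    unfolding whisker_dominant_def
  proof (intro allI ballI impI)
    fix i g g' assume g: "g \<in> min_gens I" "keys g = {Inl i, Inr i}" and g': "g' \<in> min_gens I"
    have "card {g \<in> min_gens I. keys g = {Inl i, Inr i}} = 1" using C by (simp add: alpha_def)
    then obtain x where "{g \<in> min_gens I. keys g = {Inl i, Inr i}} = {x}" by (auto simp: card_1_singleton_iff)
    with g have eq: "{g \<in> min_gens I. keys g = {Inl i, Inr i}} = {g}" by auto
    consider "Inl i \<notin> keys g'" | "keys g' = {Inl i, Inr i}" | j where "{i, j} \<in> E" "keys g' = {Inl i, Inl j}"
      using g'
    proof (cases rule: keys_min_gen_cases)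
      case (whisker_edge k)
      then show ?thesis using that(1,2) by (cases "k = i") auto
    next
      case (graph_edge k j)
      consider "k = i" | "j = i" | "k \<noteq> i" "j \<noteq> i" by blast
      then show ?thesis
      proof cases
        case 1
        then show ?thesis using graph_edge that(3)[of j] by simp
      next
        case 2
        then show ?thesis using graph_edge that(3)[of k] by (simp add: insert_commute)
      next
        case 3
        then show ?thesis using graph_edge that(1) by simp
      qed
    qed
    then show "lookup g' (Inl i) \<le> lookup g (Inl i)"
    proof cases
      case 1
      then show ?thesis by (simp add: in_keys_iff)
    next
      case 2
      then have "g' \<in> {g}" using eq g' by blast
      then show ?thesis by simp
    next
      case 3
      have "lookup g' (Inl i) \<le> mu I (Inl i) (Inl j)"
        unfolding mu_eq_Max using finite_min_gens g' 3 by (intro Max_ge) auto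
      also have "\<dots> \<le> mu I (Inl i) (Inr i)" using C 3 by blast
      also have "\<dots> = lookup g (Inl i)" unfolding mu_eq_Max eq by simp
      finally show ?thesis .
    qed
  qed
qed

text \<open>The vertices \<open>Inl i\<close> form a vertex cover of the whiskered graph.\<close>

lemma subset_var_prime: "I \<subseteq> var_prime (range Inl)"
proof
  fix p assume "p \<in> I"
  then have p: "keys p \<subseteq> exps I" by (simp add: mem_I_iff)
  have "keys e \<inter> range Inl \<noteq> {}" if "e \<in> keys p" for e
  proof -
    obtain g where g: "g \<in> min_gens I" "mdvd g e" using p \<open>e \<in> keys p\<close> ex_min_gen by blast
    then obtain i where "Inl i \<in> keys g" using min_gen_Inl by blast
    then have "lookup g (Inl i) \<noteq> 0" by (simp add: in_keys_iff)
    moreover have "lookup g (Inl i) \<le> lookup e (Inl i)" using g(2) by (simp add: mdvd_def)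
    ultimately have "Inl i \<in> keys e" by (simp add: in_keys_iff)
    then show ?thesis by blast
  qed
  then show "p \<in> var_prime (range Inl)" by (auto simp: var_prime_def)
qed

lemma card_compl_range_Inl: "card (- range (Inl :: 'a \<Rightarrow> 'a + 'a)) = card (UNIV :: 'a set)"
proof -
  have "- range (Inl :: 'a \<Rightarrow> 'a + 'a) = range Inr"
    by (auto simp: image_iff) (metis sumE)
  then show ?thesis by (simp add: card_image)
qed

lemma prime_contains_whisker:
  assumes "prime_ideal P" "I \<subseteq> P"
  shows "var (Inl i) \<in> P \<or> var (Inr i) \<in> P"
proof -
  obtain g where g: "g \<in> min_gens I" "keys g = {Inl i, Inr i}" using ex_min_gen_whisker by blast
  then have "monom g \<in> P" using min_gens_subset[OF g(1)] assms(2) by (auto simp: exps_def)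
  then show ?thesis using prime_ideal_monom[OF assms(1)] g(2) by fastforce
qed

text \<open>The vertex cover \<open>range Inl\<close> gives the lower bound. Conversely, a prime
  containing \<open>I\<close> contains a variable of each whisker pair, so it misses at most one
  variable per pair.\<close>

lemma krull_dim_eq: "krull_dim_quot I = enat (card (UNIV :: 'a set))"
proof (rule antisym)
  show "enat (card (UNIV :: 'a set)) \<le> krull_dim_quot I"
    using krull_dim_quot_ge[OF subset_var_prime] by (simp add: card_compl_range_Inl)
  show "krull_dim_quot I \<le> enat (card (UNIV :: 'a set))"
  proof (rule krull_dim_quot_le)
    fix P assume P: "prime_ideal P" "I \<subseteq> P"
    let ?A = "{v. var v \<in> P}"
    have "- ?A \<subseteq> range (\<lambda>i. if var (Inl i) \<in> P then Inr i else Inl i)"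
    proof
      fix v assume "v \<in> - ?A"
      then show "v \<in> range (\<lambda>i. if var (Inl i) \<in> P then Inr i else Inl i)"
        using prime_contains_whisker[OF P] by (cases v) (auto simp: image_iff)
    qed
    then have "card (- ?A) \<le> card (range (\<lambda>i::'a. if var (Inl i) \<in> P then Inr i else Inl i))"
      by (intro card_mono) auto
    also have "\<dots> \<le> card (UNIV :: 'a set)" by (intro card_image_le) auto
    finally show "\<exists>A. (\<forall>v\<in>A. var v \<in> P) \<and> card (- A) \<le> card (UNIV :: 'a set)"
      by (intro exI[of _ ?A]) auto
  qed
qed

lemma mem_exps_iff: "e \<in> exps I \<longleftrightarrow> (\<exists>g\<in>min_gens I. mdvd g e)"
  by (rule exps_iff[OF ideal_I])

subsection \<open>Dominant whiskers\<close>

abbreviation whisker_diff :: "'a \<Rightarrow> ('a + 'a, 'k) mpoly" where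
  "whisker_diff i \<equiv> var (Inr i) - var (Inl i)"

abbreviation merge_exp :: "'a set \<Rightarrow> ('a + 'a \<Rightarrow>\<^sub>0 nat) \<Rightarrow> ('a + 'a \<Rightarrow>\<^sub>0 nat)" where
  "merge_exp B \<equiv> map_keys (merge B)"

definition merged_exps :: "'a set \<Rightarrow> ('a + 'a \<Rightarrow>\<^sub>0 nat) set" where
  "merged_exps B = {e. \<exists>g\<in>min_gens I. mdvd (merge_exp B g) e}"

lemma upclosed_merged_exps: "upclosed (merged_exps B)"
  by (auto simp: upclosed_def merged_exps_def mdvd_def lookup_add intro: trans_le_add2)

lemma map_merge_mult:
  "map_keys (merge_exp B) (p * q) = map_keys (merge_exp B) p * (map_keys (merge_exp B) q :: ('a + 'a, 'k) mpoly)"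
  by (rule map_keys_mult) (rule map_keys_add)

lemma map_merge_var: "map_keys (merge_exp B) (var v) = (var (merge B v) :: ('a + 'a, 'k) mpoly)"
  by (simp add: var_def monom_def)

text \<open>Identifying \<open>x\<^sub>j\<close> with its whisker for \<open>j \<in> B\<close> turns \<open>I\<close> into the monomial ideal \<open>merged_exps B\<close>.\<close>

lemma ideal_gen_whisker_diffs:
  "ideal_gen (I \<union> whisker_diff ` B) = {p. keys (map_keys (merge_exp B) p) \<subseteq> merged_exps B}"
  (is "?J = ?K")
proof
  let ?\<phi> = "map_keys (merge_exp B) :: ('a + 'a, 'k) mpoly \<Rightarrow> _"
  note id = is_ideal_keys_subset[OF upclosed_merged_exps, of B, where 'k = 'k]
  have "is_ideal ?K"
    unfolding is_ideal_def
  proof (intro conjI ballI allI)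
    fix f g assume "f \<in> ?K" "g \<in> ?K"
    then show "f + g \<in> ?K" using ideal_add[OF id, of "?\<phi> f" "?\<phi> g"] by (simp add: map_keys_add)
  next
    fix f g assume "f \<in> ?K"
    then show "g * f \<in> ?K" using ideal_mult[OF id, of "?\<phi> f" "?\<phi> g"] by (simp add: map_merge_mult)
  qed simp
  moreover have "I \<subseteq> ?K"
  proof
    fix p assume "p \<in> I"
    then have p: "keys p \<subseteq> exps I" by (simp add: mem_I_iff)
    have "e \<in> merged_exps B" if e: "e \<in> keys (?\<phi> p)" for e
    proof -
      obtain d where d: "d \<in> keys p" "e = merge_exp B d" using subsetD[OF keys_map_keys e] by blast
      then obtain g where "g \<in> min_gens I" "mdvd g d" using ex_min_gen[of d I] p by blast
      moreover from \<open>mdvd g d\<close> obtain c where "d = g + c" unfolding mdvd_iff ..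
      then have "e = merge_exp B g + merge_exp B c" using d(2) by (simp add: map_keys_add)
      then have "mdvd (merge_exp B g) e" unfolding mdvd_iff ..
      ultimately show ?thesis unfolding merged_exps_def by blast
    qed
    then show "p \<in> ?K" by blast
  qed
  moreover have "?\<phi> (whisker_diff j) = 0" if "j \<in> B" for j
    using that by (simp add: map_keys_diff map_merge_var)
  then have "whisker_diff ` B \<subseteq> ?K" by auto
  ultimately show "?J \<subseteq> ?K" by (intro ideal_gen_least Un_least)
  have J: "is_ideal ?J" by (rule is_ideal_ideal_gen)
  have sup: "I \<subseteq> ?J" "whisker_diff ` B \<subseteq> ?J" using ideal_gen_superset[of "I \<union> whisker_diff ` B"] by simp_all
  \<comment> \<open>The substitution does not change classes modulo \<open>?J\<close>: this need
    only be checked on variables, where the difference is \<open>0\<close> or an adjoined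
    generator.\<close>
  have cong: "p - ?\<phi> p \<in> ?J" for p
  proof (induction p rule: polynomial_induct)
    case (const c)
    then show ?case using ideal_zero[OF J] by simp
  next
    case (var v)
    show ?case
    proof (cases v)
      case (Inl i)
      then show ?thesis using ideal_zero[OF J] by (simp add: map_merge_var)
    next
      case (Inr i)
      show ?thesis
      proof (cases "i \<in> B")
        case True
        then have "whisker_diff i \<in> ?J" using sup(2) by blast
        then show ?thesis using True Inr by (simp add: map_merge_var)
      next
        case False
        then show ?thesis using ideal_zero[OF J] Inr by (simp add: map_merge_var)
      qed
    qed
  next
    case (add p q)
    have "(p - ?\<phi> p) + (q - ?\<phi> q) = (p + q) - ?\<phi> (p + q)" by (simp add: map_keys_add)
    then show ?case using ideal_add[OF J add] by (simp only:)
  next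
    case (mult p q)
    then show ?case unfolding map_merge_mult by (intro mult_cong_ideal J)
  qed
  show "?K \<subseteq> ?J"
  proof
    fix p assume "p \<in> ?K"
    then have p: "keys (?\<phi> p) \<subseteq> merged_exps B" by simp
    have "e \<in> exps ?J" if "e \<in> keys (?\<phi> p)" for e
    proof -
      obtain g where g: "g \<in> min_gens I" "mdvd (merge_exp B g) e" using p \<open>e \<in> _\<close> by (auto simp: merged_exps_def)
      have "monom g \<in> ?J" using min_gens_subset[OF g(1)] sup(1) by (auto simp: exps_def)
      then have "?\<phi> (monom g) \<in> ?J" using ideal_cong[OF J cong[of "monom g"]] by simp
      then have "merge_exp B g \<in> exps ?J" by (simp add: exps_def monom_def)
      then show ?thesis using g(2) upclosedD(2)[OF upclosed_exps[OF J]] by (auto simp: mdvd_iff)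
    qed
    then have "?\<phi> p \<in> ?J" by (intro keys_subset_exps_imp J) auto
    then show "p \<in> ?J" using ideal_cong[OF J cong] by blast
  qed
qed

lemma lookup_merge_exp:
  assumes "k \<notin> B"
  shows "lookup (merge_exp B e) (Inl k) = lookup e (Inl k)" "lookup (merge_exp B e) (Inr k) = lookup e (Inr k)"
proof -
  have "lookup (merge_exp B e) (merge B v) = lookup e v" if "v = Inl k \<or> v = Inr k" for v
  proof (rule lookup_map_keys)
    fix v' assume "merge B v' = merge B v"
    then show "v' = v" using assms that by (cases v') (auto split: if_splits)
  qed
  from this[of "Inl k"] this[of "Inr k"] assms
  show "lookup (merge_exp B e) (Inl k) = lookup e (Inl k)" "lookup (merge_exp B e) (Inr k) = lookup e (Inr k)"
    by auto
qed

text \<open>After merging over \<open>B\<close> the ideal is monomial and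
  \<open>whisker_diff k\<close> is unchanged, so \<open>nzd_mod_var_diff\<close> applies with
  \<open>w\<close> the exponent of \<open>Inl k\<close> in the whisker generator \<open>g0\<close>.
  Only \<open>g0\<close> involves \<open>Inr k\<close>, and by dominance no generator needs more
  than \<open>w\<close> of \<open>Inl k\<close>.\<close>

lemma nzd_mod_whisker_diff:
  assumes dom: whisker_dominant and k: "k \<notin> B"
  shows "nzd_mod (ideal_gen (I \<union> whisker_diff ` B)) (whisker_diff k)"
proof -
  obtain g0 where g0: "g0 \<in> min_gens I" "keys g0 = {Inl k, Inr k}" using ex_min_gen_whisker by blast
  have nzd: "nzd_mod {p :: ('a + 'a, 'k) mpoly. keys p \<subseteq> merged_exps B} (whisker_diff k)"
  proof (rule nzd_mod_var_diff[OF upclosed_merged_exps, where w = "lookup g0 (Inl k)"])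
    fix e assume e: "e \<notin> merged_exps B" "single (Inr k) 1 + e \<in> merged_exps B"
    then obtain g where g: "g \<in> min_gens I" "mdvd (merge_exp B g) (single (Inr k) 1 + e)"
      by (auto simp: merged_exps_def)
    have "\<not> mdvd (merge_exp B g) e" using e(1) g(1) by (auto simp: merged_exps_def)
    then obtain v where v: "\<not> lookup (merge_exp B g) v \<le> lookup e v" by (auto simp: mdvd_def)
    have le: "lookup (merge_exp B g) v \<le> (1 when Inr k = v) + lookup e v" for v
      using g(2) by (simp add: mdvd_def lookup_add lookup_single)
    have "v = Inr k" using v le[of v] by (cases "v = Inr k") auto
    with v have "lookup g (Inr k) \<noteq> 0" using lookup_merge_exp(2)[OF k, of g] by auto
    then have "keys g = {Inl k, Inr k}" using min_gen_Inr[OF g(1)] by (simp add: in_keys_iff)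
    then have "g = g0" using whisker_unique[OF dom] g(1) g0 by blast
    then show "lookup g0 (Inl k) \<le> lookup e (Inl k)"
      using le[of "Inl k"] lookup_merge_exp(1)[OF k, of g] by simp
  next
    fix e assume e: "e \<notin> merged_exps B" "lookup g0 (Inl k) \<le> lookup e (Inl k)"
    show "single (Inl k) 1 + e \<notin> merged_exps B"
    proof
      assume "single (Inl k) 1 + e \<in> merged_exps B"
      then obtain g where g: "g \<in> min_gens I" "mdvd (merge_exp B g) (single (Inl k) 1 + e)"
        by (auto simp: merged_exps_def)
      have "lookup (merge_exp B g) v \<le> lookup e v" for v
      proof (cases "v = Inl k")
        case True
        have "lookup g (Inl k) \<le> lookup g0 (Inl k)" using dom g0 g(1) by (auto simp: whisker_dominant_def)
        then show ?thesis using e(2) True lookup_merge_exp(1)[OF k, of g] by simp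
      next
        case False
        then have "lookup (single (Inl k) 1 + e) v = lookup e v"
          by (simp add: lookup_add lookup_single)
        then show ?thesis using g(2) by (metis mdvd_def)
      qed
      then show False using e(1) g(1) by (auto simp: merged_exps_def mdvd_def)
    qed
  qed simp
  show ?thesis
    unfolding nzd_mod_def
  proof (intro allI impI)
    fix p assume "whisker_diff k * p \<in> ideal_gen (I \<union> whisker_diff ` B)"
    then have "keys (map_keys (merge_exp B) (whisker_diff k) * map_keys (merge_exp B) p) \<subseteq> merged_exps B"
      unfolding ideal_gen_whisker_diffs by (simp add: map_merge_mult)
    moreover have "map_keys (merge_exp B) (whisker_diff k) = whisker_diff k"
      using k by (simp add: map_keys_diff map_merge_var)
    ultimately have "keys (map_keys (merge_exp B) p) \<subseteq> merged_exps B"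
      using nzd_modD[OF nzd, of "map_keys (merge_exp B) p"] by simp
    then show "p \<in> ideal_gen (I \<union> whisker_diff ` B)"
      unfolding ideal_gen_whisker_diffs by simp
  qed
qed

lemma depth_quot_ge:
  assumes whisker_dominant
  shows "enat (card (UNIV :: 'a set)) \<le> depth_quot I"
proof -
  obtain js :: "'a list" where js: "set js = UNIV" "distinct js"
    using finite_distinct_list[of "UNIV :: 'a set"] by auto
  define fs where "fs = map whisker_diff js"
  have irr: "is_ideal (irrelevant :: ('a + 'a, 'k) mpoly set)"
    unfolding irrelevant_def by (rule is_ideal_ideal_gen)
  have fs: "set fs \<subseteq> irrelevant"
    by (auto simp: fs_def intro!: ideal_diff[OF irr] var_in_irrelevant)
  have "I \<subseteq> irrelevant"
    using subset_var_prime var_prime_subset[OF irr var_in_irrelevant] by blast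
  then have "ideal_gen (I \<union> set fs) \<subseteq> irrelevant" using fs by (intro ideal_gen_least irr) auto
  moreover have "(1 :: ('a + 'a, 'k) mpoly) \<notin> irrelevant" using degree_irrelevant[of 1 0] by auto
  ultimately have "ideal_gen (I \<union> set fs) \<noteq> UNIV" by blast
  moreover have "weakly_regular I fs"
    unfolding weakly_regular_iff[OF ideal_I]
  proof (intro allI impI)
    fix k assume k: "k < length fs"
    then have "js ! k \<notin> set (take k js)"
      using js(2) by (auto simp: fs_def in_set_conv_nth nth_eq_iff_index_eq)
    from nzd_mod_whisker_diff[OF assms this]
    show "nzd_mod (ideal_gen (I \<union> set (take k fs))) (fs ! k)"
      using k by (simp add: fs_def take_map)
  qed
  ultimately have "regular_seq I fs"
    using fs by (simp add: regular_seq_iff[OF ideal_I] ideal_gen_Un_list[OF ideal_I])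
  then have "enat (length fs) \<le> depth_quot I" unfolding depth_quot_def by (intro Sup_upper) auto
  moreover have "length fs = card (UNIV :: 'a set)"
    using distinct_card[OF js(2)] js(1) by (simp add: fs_def)
  ultimately show ?thesis by simp
qed

text \<open>An associated prime containing both variables of a pair would contain
  \<open>whisker_diff i\<close>, a non-zero-divisor modulo \<open>I\<close>. So it contains exactly
  one variable per pair, and it remains to see that these generate it.\<close>

lemma ass_height:
  assumes dom: whisker_dominant and "P \<in> ass I"
  shows "height P = enat (card (UNIV :: 'a set))"
proof -
  obtain f where P: "prime_ideal P" and f: "P = {g. g * f \<in> I}"
    using assms(2) by (auto simp: ass_def)
  have "f \<notin> I"
  proof
    assume "f \<in> I"
    then have "P = UNIV" using f ideal_mult[OF ideal_I] by auto
    then show False using P by (simp add: prime_ideal_def)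
  qed
  have nzd: "nzd_mod I (whisker_diff i)" for i
    using nzd_mod_whisker_diff[OF dom, of i "{}"] by (simp add: ideal_gen_ideal[OF ideal_I])
  have idP: "is_ideal P" using P by (simp add: prime_ideal_def)
  have one: "var (Inl i) \<in> P \<longleftrightarrow> var (Inr i) \<notin> P" for i
  proof
    assume "var (Inl i) \<in> P"
    show "var (Inr i) \<notin> P"
    proof
      assume "var (Inr i) \<in> P"
      then have "whisker_diff i \<in> P" using ideal_diff[OF idP] \<open>var (Inl i) \<in> P\<close> by blast
      then have "whisker_diff i * f \<in> I" using f by simp
      then show False using nzd_modD[OF nzd] \<open>f \<notin> I\<close> by blast
    qed
  next
    assume "var (Inr i) \<notin> P"
    moreover have "I \<subseteq> P" using f ideal_mult'[OF ideal_I] by auto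
    ultimately show "var (Inl i) \<in> P" using prime_contains_whisker[OF P] by blast
  qed
  define A where "A = {v. var v \<in> P}"
  have "A = range (\<lambda>i. if var (Inl i) \<in> P then Inl i else Inr i)"
  proof (rule set_eqI)
    fix v show "v \<in> A \<longleftrightarrow> v \<in> range (\<lambda>i. if var (Inl i) \<in> P then Inl i else Inr i)"
      using one by (cases v) (auto simp: A_def image_iff split: if_splits)
  qed
  moreover have "inj (\<lambda>i. if var (Inl i) \<in> P then Inl i else Inr i :: 'a + 'a)"
    by (rule injI) (auto split: if_splits)
  ultimately have cardA: "card A = card (UNIV :: 'a set)" by (simp only: card_image)
  have "P = var_prime A"
  proof
    show "var_prime A \<subseteq> P" by (rule var_prime_subset[OF idP]) (simp add: A_def)
    show "P \<subseteq> var_prime A"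
    proof
      fix p assume p: "p \<in> P"
      \<comment> \<open>Discard the part of \<open>f\<close> in \<open>I\<close> and the part of
        \<open>p\<close> in \<open>var_prime A\<close>. The product \<open>p1 * f1\<close> lies in
        \<open>I\<close>, yet none of its monomials can, so it is zero.\<close>
      obtain f1 f2 where f12: "f = f1 + f2" "keys f1 \<subseteq> - exps I" "keys f2 \<subseteq> exps I"
        by (rule ex_split_keys)
      obtain p1 p2 where p12: "p = p1 + p2" "keys p1 \<subseteq> - {e. keys e \<inter> A \<noteq> {}}" "keys p2 \<subseteq> {e. keys e \<inter> A \<noteq> {}}"
        by (rule ex_split_keys)
      have "f2 \<in> I" using f12 by (simp add: mem_I_iff)
      have "p2 \<in> var_prime A" using p12 by (simp add: var_prime_def)
      then have "p1 \<in> P"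
        using p p12(1) \<open>var_prime A \<subseteq> P\<close> ideal_diff[OF idP, of p p2] by auto
      then have "p1 * f1 \<in> I"
        using f f12(1) ideal_diff[OF ideal_I, of "p1 * f" "p1 * f2"] ideal_mult[OF ideal_I \<open>f2 \<in> I\<close>, of p1]
        by (simp add: algebra_simps)
      have kill: "single v 1 + e \<in> exps I" if "v \<in> A" "e \<in> keys f1" for v e
      proof -
        have "var v * f \<in> I" using that(1) f by (simp add: A_def)
        then have "var v * f1 \<in> I"
          using f12(1) ideal_diff[OF ideal_I, of "var v * f" "var v * f2"] ideal_mult[OF ideal_I \<open>f2 \<in> I\<close>, of "var v"]
          by (simp add: algebra_simps)
        then show ?thesis using that(2) by (auto simp: mem_I_iff var_def keys_monom_mult)
      qed
      \<comment> \<open>Multiply by variables outside \<open>A\<close> one at a time. If such a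
        variable sent \<open>n + e\<close> into \<open>I\<close>, so would its partner, which lies
        in \<open>A\<close>; then \<open>whisker_diff i\<close> would annihilate
        \<open>monom (n + e)\<close> modulo \<open>I\<close>.\<close>
      have keep: "n + e \<notin> exps I" if "keys n \<inter> A = {}" "e \<in> keys f1" for n e
        using that(1)
      proof (induction n rule: exponent_induct)
        case zero
        then show ?case using f12(2) that(2) by auto
      next
        case (step n a)
        have keys: "keys (n + single a 1) = insert a (keys n)"
          by (auto simp: in_keys_iff lookup_add lookup_single when_def split: if_splits)
        then have n: "n + e \<notin> exps I" and "a \<notin> A" using step by auto
        show ?case
        proof
          assume "n + single a 1 + e \<in> exps I"
          then have a: "single a 1 + (n + e) \<in> exps I" by (simp add: ac_simps)
          have up: "single v 1 + (n + e) \<in> exps I" if "v \<in> A" for v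
            using upclosedD(1)[OF upclosed_exps[OF ideal_I] kill[OF that \<open>e \<in> keys f1\<close>], of n]
            by (simp add: ac_simps)
          obtain i where i: "a = Inl i \<or> a = Inr i" by (cases a) auto
          have "single (Inl i) 1 + (n + e) \<in> exps I" "single (Inr i) 1 + (n + e) \<in> exps I"
            using i a up \<open>a \<notin> A\<close> one[of i] by (auto simp: A_def)
          then have "whisker_diff i * monom (n + e) \<in> I"
            using ideal_diff[OF ideal_I] by (auto simp: exps_def monom_add var_def left_diff_distrib)
          then show False using nzd_modD[OF nzd] n by (auto simp: exps_def)
        qed
      qed
      have "keys (p1 * f1) \<subseteq> - exps I"
      proof
        fix e assume "e \<in> keys (p1 * f1)"
        then obtain a b where "a \<in> keys p1" "b \<in> keys f1" "e = a + b" by (rule keys_multE)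
        then show "e \<in> - exps I" using keep[of a b] p12(2) by blast
      qed
      moreover have "keys (p1 * f1) \<subseteq> exps I" using \<open>p1 * f1 \<in> I\<close> by (simp add: mem_I_iff)
      ultimately have "keys (p1 * f1) = {}" by blast
      then have "p1 = 0 \<or> f1 = 0" using poly_no_zero_divisors[of p1 f1] by simp
      moreover have "f1 \<noteq> 0" using \<open>f \<notin> I\<close> f12(1) \<open>f2 \<in> I\<close> by auto
      ultimately show "p \<in> var_prime A" using p12(1) \<open>p2 \<in> var_prime A\<close> by simp
    qed
  qed
  then show ?thesis by (simp add: height_var_prime cardA)
qed

subsection \<open>Whiskers that are not dominant\<close>

text \<open>Inverting both variables of a pair makes the whisker generator a unit.\<close>

lemma whisker_pair_not_big:
  assumes N: "\<And>g v. g \<in> min_gens I \<Longrightarrow> lookup g v \<le> N" and V: "big N V + h \<notin> exps I"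
  shows "Inl j \<notin> V \<or> Inr j \<notin> V"
proof (rule ccontr)
  assume "\<not> (Inl j \<notin> V \<or> Inr j \<notin> V)"
  then have jV: "Inl j \<in> V" "Inr j \<in> V" by auto
  obtain g where g: "g \<in> min_gens I" "keys g = {Inl j, Inr j}" using ex_min_gen_whisker by blast
  have "lookup g v \<le> lookup (big N V + h) v" for v
  proof (cases "v \<in> {Inl j, Inr j}")
    case True
    then show ?thesis using N[OF g(1), of v] jV by (auto simp: lookup_add lookup_big)
  next
    case False
    then have "v \<notin> keys g" using g(2) by simp
    then show ?thesis by (simp add: in_keys_iff)
  qed
  then show False using V g(1) by (auto simp: mem_exps_iff mdvd_def)
qed

text \<open>Starting from the monomial \<open>1\<close>, a maximal set \<open>V\<close> of inverted
  variables contains at most one variable per pair, and \<open>depth_quot_le\<close> bounds the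
  depth by its size.\<close>

lemma depth_le_dim: "depth_quot I \<le> enat (card (UNIV :: 'a set))"
proof -
  obtain N where N: "\<And>g v. g \<in> min_gens I \<Longrightarrow> lookup g v \<le> N" using min_gens_bound by blast
  have "big N {} + 0 \<notin> exps I"
    using subset_var_prime by (auto simp: big_def exps_def var_prime_def)
  from ex_maximal_big[OF this] obtain V where V: "big N V + 0 \<notin> exps I" "\<And>v. v \<notin> V \<Longrightarrow> big N (insert v V) + 0 \<in> exps I"
    by blast
  obtain h where h: "h \<notin> exps I" "\<forall>v\<in>- V. single v 1 + h \<in> exps I"
    using ass_var_prime(1)[OF mono_I N V] by blast
  have depth: "depth_quot I \<le> enat (card (- (- V)))"
    using h by (intro depth_quot_le[OF mono_I h(1)]) auto
  have "V \<subseteq> range (\<lambda>j. if Inl j \<in> V then Inl j else Inr j)"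
  proof
    fix v assume "v \<in> V"
    then show "v \<in> range (\<lambda>j. if Inl j \<in> V then Inl j else Inr j)"
      using whisker_pair_not_big[OF N V(1)] by (cases v) (auto simp: image_iff)
  qed
  then have "card V \<le> card (range (\<lambda>j. if Inl j \<in> V then Inl j else Inr j :: 'a + 'a))"
    by (intro card_mono) auto
  also have "\<dots> \<le> card (UNIV :: 'a set)" by (intro card_image_le) auto
  finally have "enat (card (- (- V))) \<le> enat (card (UNIV :: 'a set))" by simp
  with depth show ?thesis by (rule order_trans)
qed

lemma not_dominant_consequences:
  assumes "\<not> whisker_dominant"
  shows "has_embedded_prime I" and "depth_quot I < enat (card (UNIV :: 'a set))"
proof -
  obtain i g1 g2 where g1: "g1 \<in> min_gens I" "keys g1 = {Inl i, Inr i}"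
    and g2: "g2 \<in> min_gens I" and lt: "lookup g1 (Inl i) < lookup g2 (Inl i)"
    using assms by (auto simp: whisker_dominant_def not_le)
  have "Inl i \<in> keys g2" using lt by (simp add: in_keys_iff)
  then have "card (keys g2 - {Inl i}) = 1" using card_keys_min_gen[OF g2] by simp
  then obtain u where "keys g2 - {Inl i} = {u}" by (auto simp: card_1_singleton_iff)
  with \<open>Inl i \<in> keys g2\<close> have u: "keys g2 = {Inl i, u}" "u \<noteq> Inl i" by blast+
  obtain N where N: "\<And>g v. g \<in> min_gens I \<Longrightarrow> lookup g v \<le> N" using min_gens_bound by blast
  \<comment> \<open>This is \<open>g2\<close> with its exponent of \<open>Inl i\<close> lowered to
    that of \<open>g1\<close>, hence outside \<open>I\<close>. A high power of \<open>Inr i\<close>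
    makes it a multiple of \<open>g1\<close>, and a high power of \<open>Inl i\<close> makes it a
    multiple of \<open>g2\<close>; so neither variable can be inverted.\<close>
  define h where "h = single (Inl i) (lookup g1 (Inl i)) + single u (lookup g2 u)"
  have lookup_h: "lookup h v = (if v = Inl i then lookup g1 (Inl i) else if v = u then lookup g2 u else 0)" for v
    using u(2) by (auto simp: h_def lookup_add lookup_single when_def)
  have "h \<notin> exps I"
  proof
    assume "h \<in> exps I"
    then obtain g where g: "g \<in> min_gens I" "mdvd g h" by (auto simp: mem_exps_iff)
    have "lookup g v \<le> lookup g2 v" for v
    proof -
      have "lookup g v \<le> lookup h v" using g(2) by (simp add: mdvd_def)
      then show ?thesis using lt by (auto simp: lookup_h split: if_splits)
    qed
    then have "g = g2" using min_gens_antichain[OF g(1) g2] by (simp add: mdvd_def)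
    moreover have "lookup g (Inl i) \<le> lookup g1 (Inl i)" using g(2) lookup_h[of "Inl i"] by (metis mdvd_def)
    ultimately show False using lt by simp
  qed
  then have "big N {} + h \<notin> exps I" by (simp add: big_def)
  from ex_maximal_big[OF this] obtain V where V: "big N V + h \<notin> exps I" "\<And>v. v \<notin> V \<Longrightarrow> big N (insert v V) + h \<in> exps I"
    by blast
  have "Inr i \<notin> V"
  proof
    assume "Inr i \<in> V"
    have "lookup g1 v \<le> lookup (big N V + h) v" for v
    proof (cases "v \<in> keys g1")
      case True
      then show ?thesis using N[OF g1(1), of v] \<open>Inr i \<in> V\<close> g1(2) by (auto simp: lookup_add lookup_big lookup_h)
    qed (simp add: in_keys_iff)
    then show False using V(1) g1(1) by (auto simp: mem_exps_iff mdvd_def)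
  qed
  have "Inl i \<notin> V"
  proof
    assume "Inl i \<in> V"
    have "lookup g2 v \<le> lookup (big N V + h) v" for v
    proof (cases "v \<in> keys g2")
      case True
      then show ?thesis using N[OF g2, of v] \<open>Inl i \<in> V\<close> u by (auto simp: lookup_add lookup_big lookup_h)
    qed (simp add: in_keys_iff)
    then show False using V(1) g2 by (auto simp: mem_exps_iff mdvd_def)
  qed
  have P: "var_prime (- V) \<in> ass I" by (rule ass_var_prime(2)[OF mono_I N V])
  \<comment> \<open>Replacing \<open>h\<close> by the monomial \<open>1\<close> allows
    \<open>V\<close> to be enlarged to \<open>W\<close>, which gives a smaller associated
    prime.\<close>
  have "big N V + 0 \<notin> exps I"
    using V(1) upclosedD(2)[OF upclosed_exps[OF ideal_I], of "big N V" h] by auto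
  from ex_maximal_big[OF this] obtain W where W: "V \<subseteq> W" "big N W + 0 \<notin> exps I" "\<And>v. v \<notin> W \<Longrightarrow> big N (insert v W) + 0 \<in> exps I"
    by blast
  have Q: "var_prime (- W) \<in> ass I" by (rule ass_var_prime(2)[OF mono_I N W(2,3)])
  \<comment> \<open>If neither variable were in \<open>W\<close>, inverting \<open>Inr i\<close> too
    would bring \<open>1\<close> into \<open>I\<close> through a generator avoiding
    \<open>Inl i\<close>. It then avoids \<open>Inr i\<close> as well, so inverting \<open>W\<close>
    alone would suffice.\<close>
  have "Inl i \<in> W \<or> Inr i \<in> W"
  proof (rule ccontr)
    assume *: "\<not> (Inl i \<in> W \<or> Inr i \<in> W)"
    then have "big N (insert (Inr i) W) \<in> exps I" using W(3) by simp
    then obtain g where g: "g \<in> min_gens I" "mdvd g (big N (insert (Inr i) W))" by (auto simp: mem_exps_iff)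
    have le: "lookup g v \<le> (N when v \<in> insert (Inr i) W)" for v
      using g(2) by (simp add: mdvd_def lookup_big)
    have "Inl i \<notin> keys g" using le[of "Inl i"] * by (simp add: in_keys_iff)
    then have "Inr i \<notin> keys g" using min_gen_Inr[OF g(1)] by auto
    then have "lookup g v \<le> lookup (big N W) v" for v
      using le[of v] by (cases "v = Inr i") (auto simp: lookup_big in_keys_iff when_def)
    then have "mdvd g (big N W + 0)" by (simp add: mdvd_def)
    then show False using W(2) g(1) unfolding mem_exps_iff by blast
  qed
  then have "- W \<subset> - V" using W(1) \<open>Inl i \<notin> V\<close> \<open>Inr i \<notin> V\<close> by auto
  then have "var_prime (- W) \<subset> (var_prime (- V) :: ('a + 'a, 'k) mpoly set)"
    by (rule var_prime_strict_mono)
  with P Q show "has_embedded_prime I" unfolding has_embedded_prime_def by blast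
  obtain h' where h': "h' \<notin> exps I" "\<forall>v\<in>- V. single v 1 + h' \<in> exps I"
    using ass_var_prime(1)[OF mono_I N V] by blast
  have depth: "depth_quot I \<le> enat (card (- (- V)))"
    using h' by (intro depth_quot_le[OF mono_I h'(1)]) auto
  \<comment> \<open>At most one variable per pair and none from pair \<open>i\<close>: this missing
    pair makes the depth bound strict.\<close>
  have "V \<subseteq> (\<lambda>j. if Inl j \<in> V then Inl j else Inr j) ` (UNIV - {i})"
  proof
    fix v assume "v \<in> V"
    then show "v \<in> (\<lambda>j. if Inl j \<in> V then Inl j else Inr j) ` (UNIV - {i})"
      using whisker_pair_not_big[OF N V(1)] \<open>Inl i \<notin> V\<close> \<open>Inr i \<notin> V\<close>
      by (cases v) (auto simp: image_iff)
  qed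
  then have "card V \<le> card ((\<lambda>j. if Inl j \<in> V then Inl j else Inr j :: 'a + 'a) ` (UNIV - {i}))"
    by (intro card_mono) auto
  also have "\<dots> \<le> card (UNIV - {i})" by (intro card_image_le) auto
  also have "\<dots> < card (UNIV :: 'a set)" by (intro psubset_card_mono) auto
  finally have "enat (card (- (- V))) < enat (card (UNIV :: 'a set))" by simp
  with depth show "depth_quot I < enat (card (UNIV :: 'a set))" by (rule order_le_less_trans)
qed

end

theorem theorem3p7:
  fixes I :: "('a::finite + 'a, 'k::field) mpoly set"
    and E :: "'a set set"
  assumes H_simple: "\<forall>e\<in>E. card e = 2"
    and supp2: "support2 I"
    and whisker: "graph_edges I = (\<lambda>e. Inl ` e) ` E \<union> {{Inl i, Inr i} | i. True}"
  shows "(cohen_macaulay_quot I \<longleftrightarrow> unmixed I)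
       \<and> (unmixed I \<longleftrightarrow> \<not> has_embedded_prime I)
       \<and> (\<not> has_embedded_prime I \<longleftrightarrow>
            (\<forall>i. alpha I (Inl i) (Inr i) = 1 \<and>
                 (\<forall>j. {i, j} \<in> E \<longrightarrow> mu I (Inl i) (Inr i) \<ge> mu I (Inl i) (Inl j))))"
proof -
  interpret whiskered_ideal I E
    using assms by unfold_locales
  \<comment> \<open>Heights strictly increase along strict inclusions of primes.\<close>
  have embedded: "\<not> unmixed I" if "has_embedded_prime I"
    using that height_strict_mono unfolding has_embedded_prime_def unmixed_def ass_def
    by (metis (mono_tags, lifting) mem_Collect_eq order_less_irrefl)
  \<comment> \<open>The remaining conditions all hold if \<open>whisker_dominant\<close> does and
    all fail otherwise, which yields every equivalence at once.\<close>
  have "cohen_macaulay_quot I \<and> unmixed I \<and> \<not> has_embedded_prime I" if whisker_dominant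
    using depth_quot_ge[OF that] depth_le_dim ass_height[OF that] embedded
    by (auto simp: cohen_macaulay_quot_def krull_dim_eq unmixed_def)
  moreover have "\<not> cohen_macaulay_quot I \<and> \<not> unmixed I \<and> has_embedded_prime I" if "\<not> whisker_dominant"
    using not_dominant_consequences[OF that] embedded
    by (auto simp: cohen_macaulay_quot_def krull_dim_eq)
  ultimately show ?thesis unfolding whisker_dominant_iff[symmetric] by blast
qed

end
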